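(* Let $\mu,\nu\in\mathbb{R}$ with $\mu\in(-\frac12,\frac12)$ and $|\nu|\in(|\mu|,\mu+1)$. Then the entire function $z\mapsto {}_1F_2\left(1;\frac{\mu-\nu+3}{2},\frac{\mu+\nu+3}{2};z\right)$ possesses only real negative zeros. The zeros are simple and are contained in the intervals $\left(-\frac{(k+1)^2\pi^2}{4},-\frac{k^2\pi^2}{4}\right)$, $k=1,2,\ldots$, each interval containing exactly one zero.
   Context: ${}_1F_2(a;b,c;z)=\sum_{n\ge0}\frac{(a)_n}{(b)_n(c)_n}\frac{z^n}{n!}$ is the generalized hypergeometric function, with $(x)_n$ the Pochhammer symbol. *)

theory Defs
  imports "HOL-Complex_Analysis.Complex_Analysis"
begin

text \<open>
  The series is meaningful only when neither \<open>b\<close> nor \<open>c\<close> is a non-positive integer;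
  otherwise the convention \<open>x / 0 = 0\<close> silently drops terms.
\<close>

definition hypergeo_1F2 :: "complex \<Rightarrow> complex \<Rightarrow> complex \<Rightarrow> complex \<Rightarrow> complex" where
  "hypergeo_1F2 a b c z =
     (\<Sum>n. pochhammer a n / (pochhammer b n * pochhammer c n) * (z ^ n / fact n))"

lemma hypergeo_1F2_eq_eval_fps:
  "hypergeo_1F2 a b c z = eval_fps (fps_hypergeo [a] [b, c] 1) z"
  by (simp add: hypergeo_1F2_def eval_fps_def mult_ac)

lemma hypergeo_1F2_sums:
  "(\<lambda>n. pochhammer a n / (pochhammer b n * pochhammer c n) * (z ^ n / fact n))
     sums hypergeo_1F2 a b c z"
proof -
  define f where "f = (\<lambda>n. pochhammer a n / (pochhammer b n * pochhammer c n) * (z ^ n / fact n))"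
  define r where "r = (\<lambda>n. z * ((a + of_nat n) * inverse (b + of_nat n))
                            * (inverse (c + of_nat n) * inverse (1 + of_nat n)))"
  have step: "f (Suc n) = r n * f n" for n
    by (simp add: f_def r_def pochhammer_Suc divide_inverse mult_ac)
  have inv: "(\<lambda>n. inverse (d + of_nat n)) \<longlonglongrightarrow> 0" for d :: complex
    by (rule filterlim_compose[OF tendsto_inverse_0])
      (intro tendsto_add_filterlim_at_infinity[OF tendsto_const] tendsto_of_nat)
  have "(\<lambda>n. 1 + (a - b) * inverse (b + of_nat n)) \<longlonglongrightarrow> 1 + (a - b) * 0"
    by (intro tendsto_intros inv)
  moreover have "\<forall>\<^sub>F n in sequentially. 1 + (a - b) * inverse (b + of_nat n)
                   = (a + of_nat n) * inverse (b + of_nat n)"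
    using eventually_gt_at_top[of "nat \<lceil>norm b\<rceil>"]
  proof eventually_elim
    case (elim n)
    hence "norm b < norm (of_nat n :: complex)"
      by (simp add: nat_less_iff ceiling_less_iff) linarith
    hence "b + of_nat n \<noteq> 0"
      by (metis add_eq_0_iff norm_minus_cancel order_less_irrefl)
    thus ?case by (simp add: field_simps)
  qed
  ultimately have "(\<lambda>n. (a + of_nat n) * inverse (b + of_nat n)) \<longlonglongrightarrow> 1 + (a - b) * 0"
    by (rule Lim_transform_eventually)
  hence "r \<longlonglongrightarrow> z * (1 + (a - b) * 0) * (0 * 0)"
    unfolding r_def by (intro tendsto_intros inv)
  hence "r \<longlonglongrightarrow> 0"
    by simp
  then obtain N where "\<And>n. n \<ge> N \<Longrightarrow> norm (r n) < 1 / 2"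
    using LIMSEQ_D[of r 0 "1 / 2"] by auto
  hence "norm (f (Suc n)) \<le> 1 / 2 * norm (f n)" if "n \<ge> N" for n
    unfolding step norm_mult using that by (intro mult_right_mono) (auto simp: less_imp_le)
  hence "summable f"
    by (intro summable_ratio_test[of "1 / 2" N]) auto
  thus ?thesis
    unfolding f_def hypergeo_1F2_def by (rule summable_sums)
qed

end

theory Submission
  imports Defs
begin

text \<open>
  With \<open>c = \<mu> + 1/2\<close>, \<open>a = (\<mu> + \<nu>)/2\<close>, \<open>b = (\<mu> - \<nu>)/2\<close>, the substitution \<open>-z\<^sup>2/4\<close> turns the
  function into a sine transform: up to a positive constant,
  \<open>z F (-z\<^sup>2/4)\<close> is \<open>S z = \<integral>\<^sub>0\<^sup>1 f t sin (z t) dt\<close>, where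
  \<open>f t = (1 - t\<^sup>2) powr (c - 1) * \<^sub>2F\<^sub>1 (a, b; c; 1 - t\<^sup>2)\<close>. Comparing coefficients amounts to evaluating
  the moments of \<open>f\<close>, and these obey the right two-term recursion because of the contiguous
  relation behind Gauss' summation theorem (\<open>gauss_sum_rec\<close>, \<open>lommel_sine_transform\<close>).
  The hypothesis on \<open>\<mu>\<close> says that \<open>0 < c < 1\<close>, and the one on \<open>\<nu>\<close> gives \<open>a * b < 0\<close> and
  \<open>a, b > -1\<close>, so every coefficient of the \<open>\<^sub>2F\<^sub>1\<close> series after the constant one is negative. Hence
  both factors of \<open>f\<close> increase with \<open>t\<close>, and \<open>f\<close> is positive
  since its value at \<open>0\<close> is a positive Gauss sum (\<open>gauss_sum_pos\<close>, \<open>lommel_weight_growth\<close>).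

  The theorem is thus a case of Polya's theorem on sine transforms of increasing functions. The
  proof here shows that \<open>S z / sin z\<close> is a Nevanlinna function of \<open>z\<^sup>2\<close>. An increasing weight is a
  superposition of indicator functions of intervals \<open>[s, 1]\<close>, whose sine transforms are
  \<open>(cos (z s) - cos z) / z\<close>. So it suffices that \<open>(cos (z s) - cos z) / (z sin z)\<close> has nonnegative
  imaginary part in the open first quadrant. This is \<open>cos_kernel_le\<close>; in place of the
  partial fraction expansion of this quotient, the proof uses a doubling inequality in \<open>s\<close>
  (\<open>cos_kernel_doubling\<close>), the analogue of \<open>1 - cos (2 \<theta>) \<le> 4 (1 - cos \<theta>)\<close>, whose defect is a
  multiple of a squared \<open>L\<^sup>2\<close> norm.

  Hence \<open>S\<close> has no zeros in the open first quadrant, nor in its mirror image. Approaching the real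
  axis, the same inequality gives \<open>S' sin - S cos > 0\<close> away from the zeros of \<open>sin\<close>, so \<open>S / sin\<close>
  increases strictly between consecutive multiples of \<open>\<pi>\<close>: there is at most one zero in each
  gap, and it is simple. At \<open>k \<pi>\<close> the sign of \<open>S\<close> is \<open>(-1) ^ (k + 1)\<close>, again by monotonicity of \<open>f\<close>,
  so each gap with \<open>k \<ge> 1\<close> does contain a zero, while \<open>S > 0\<close> on \<open>(0, \<pi>]\<close>. On the half-line
  \<open>[0, \<infinity>)\<close> the power series of \<open>F\<close> has nonnegative terms, starting with \<open>1\<close>.
\<close>

section \<open>Integrals against an increasing weight\<close>

lemma absolutely_integrable_mult_continuous:
  fixes f :: "real \<Rightarrow> real" and g :: "real \<Rightarrow> 'a::euclidean_space"
  assumes f: "f absolutely_integrable_on {a..b}" and g: "continuous_on {a..b} g"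
  shows "(\<lambda>t. f t *\<^sub>R g t) absolutely_integrable_on {a..b}"
proof -
  have "(\<lambda>t. (\<lambda>(x::'a) (y::real). y *\<^sub>R x) (g t) (f t)) absolutely_integrable_on {a..b}"
  proof (rule absolutely_integrable_bounded_measurable_product[where h = "\<lambda>(x::'a) (y::real). y *\<^sub>R x"])
    show "bilinear (\<lambda>(x::'a) (y::real). y *\<^sub>R x)"
      by (auto simp: bilinear_def linear_iff algebra_simps)
    show "g \<in> borel_measurable (lebesgue_on {a..b})"
      by (rule continuous_imp_measurable_on_sets_lebesgue[OF g]) auto
    show "bounded (g ` {a..b})"
      by (intro compact_imp_bounded compact_continuous_image g) auto
  qed (use f in auto)
  thus ?thesis by simp
qed

text \<open>
  Formally, \<open>f = f 0 + \<integral> \<one>\<^bsub>[s, 1]\<^esub> df(s)\<close> and each indicator contributes a nonnegative tail of \<open>g\<close>.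
  The second mean value theorem replaces this Stieltjes integral on \<open>[0, r]\<close>, and \<open>r\<close> then tends
  to \<open>1\<close>. The detour through \<open>r\<close> admits weights that are unbounded at \<open>1\<close>.
\<close>
lemma integral_mono_weight_ge:
  fixes f g :: "real \<Rightarrow> real"
  assumes f: "f absolutely_integrable_on {0..1}"
    and nonneg: "0 \<le> f 0" and mono: "mono_on {0..<1} f"
    and g: "continuous_on {0..1} g"
    and tail: "\<And>s. s \<in> {0..1} \<Longrightarrow> 0 \<le> integral {s..1} g"
  shows "f 0 * integral {0..1} g \<le> integral {0..1} (\<lambda>t. f t * g t)"
proof -
  define H where "H = (\<lambda>s. integral {s..1} g)"
  have fi: "f integrable_on {0..1}"
    using f by (rule absolutely_integrable_on_def[THEN iffD1, THEN conjunct1])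
  have gi: "g integrable_on {s..r}" if "0 \<le> s" "r \<le> 1" for s r
    by (rule integrable_continuous_interval) (rule continuous_on_subset[OF g], use that in auto)
  have fgi: "(\<lambda>t. f t * g t) integrable_on {0..1}"
    using absolutely_integrable_mult_continuous[OF f g]
    by (simp add: absolutely_integrable_on_def)
  have fpos: "0 \<le> f t" if "0 \<le> t" "t < 1" for t
    using mono_onD[OF mono, of 0 t] nonneg that by auto
  obtain B where B: "B > 0" "\<And>t. t \<in> {0..1} \<Longrightarrow> \<bar>g t\<bar> \<le> B"
  proof -
    have "bounded (g ` {0..1})"
      by (intro compact_imp_bounded compact_continuous_image g) auto
    thus ?thesis using that unfolding bounded_pos by auto
  qed
  define P where "P = (\<lambda>r. integral {0..r} (\<lambda>t. f t * g t))"
  define I where "I = (\<lambda>r. integral {0..r} f)"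
  have main: "f 0 * H 0 \<le> P r + B * (I 1 - I r)" if r: "0 \<le> r" "r < 1" for r
  proof -
    obtain c where c: "c \<in> {0..r}"
      and eq: "P r = f 0 * integral {0..c} g + f r * integral {c..r} g"
    proof -
      have m: "f s \<le> f t" if "0 \<le> s" "s \<le> t" "t \<le> r" for s t
        using mono_onD[OF mono, of s t] that r by auto
      have "g integrable_on {0..r}" using gi r by simp
      from second_mean_value_theorem[OF this r(1), of f, OF m] that show ?thesis
        unfolding P_def by blast
    qed
    have 1: "integral {0..c} g = H 0 - H c"
      using Henstock_Kurzweil_Integration.integral_combine[of 0 c 1 g] gi[of 0 1] c r by (auto simp: H_def)
    have 2: "integral {c..r} g = H c - H r"
      using Henstock_Kurzweil_Integration.integral_combine[of c r 1 g] gi[of c 1] c r by (auto simp: H_def)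
    have Hr: "H r \<le> B * (1 - r)"
    proof -
      have "norm (integral {r..1} g) \<le> B * (1 - r)"
        by (rule integral_bound) (use r B continuous_on_subset[OF g] in auto)
      thus ?thesis by (simp add: H_def)
    qed
    \<comment> \<open>Monotonicity turns integrability into the bound on \<open>f r\<close> that makes the boundary term
      \<open>f r * H r\<close> vanish as \<open>r\<close> tends to \<open>1\<close>.\<close>
    have If: "f r * (1 - r) \<le> I 1 - I r"
    proof -
      have fir: "f integrable_on {r..1}"
        by (rule integrable_on_subinterval[OF fi]) (use r in auto)
      define f' where "f' = (\<lambda>t. if t = 1 then f r else f t)"
      have eqf: "integral {r..1} f = integral {r..1} f'"
        by (rule integral_spike[of "{1}"]) (auto simp: f'_def)
      have f'i: "f' integrable_on {r..1}"
        by (rule integrable_spike[OF fir, of "{1}"]) (auto simp: f'_def)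
      have "integral {r..1} (\<lambda>t. f r) \<le> integral {r..1} f'"
        by (rule integral_le[OF _ f'i]) (use r mono_onD[OF mono] in \<open>auto simp: f'_def\<close>)
      moreover have "I r + integral {r..1} f = I 1"
        unfolding I_def by (rule Henstock_Kurzweil_Integration.integral_combine) (use r fi in auto)
      ultimately show ?thesis using r eqf by (simp add: mult.commute)
    qed
    have "f 0 * H c \<le> f r * H c"
      using tail[of c] mono_onD[OF mono, of 0 r] c r by (intro mult_right_mono) (auto simp: H_def)
    moreover have "f r * H r \<le> f r * (B * (1 - r))"
      using Hr fpos[of r] r by (intro mult_left_mono) auto
    moreover have "B * (f r * (1 - r)) \<le> B * (I 1 - I r)"
      using If B by (intro mult_left_mono) auto
    ultimately show ?thesis
      unfolding eq 1 2 by (simp add: algebra_simps)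
  qed
  have cP: "continuous_on {0..1} P" and cI: "continuous_on {0..1} I"
    unfolding P_def I_def using fgi fi by (auto intro: indefinite_integral_continuous_1)
  have "((\<lambda>r. P r + B * (I 1 - I r)) \<longlongrightarrow> P 1 + B * (I 1 - I 1)) (at 1 within {0..1})"
    using cP cI unfolding continuous_on by (intro tendsto_intros) auto
  hence lim: "((\<lambda>r. P r + B * (I 1 - I r)) \<longlongrightarrow> P 1 + B * (I 1 - I 1)) (at_left 1)"
    by (simp add: at_within_Icc_at_left)
  have "\<forall>\<^sub>F r in at_left (1::real). f 0 * H 0 \<le> P r + B * (I 1 - I r)"
    using eventually_at_left_real[of 0 1] by (auto elim!: eventually_mono intro!: main)
  from tendsto_lowerbound[OF lim this] show ?thesis
    by (simp add: P_def H_def)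
qed

section \<open>The kernel inequality for cosines\<close>

text \<open>
  For a solution of \<open>u'' = - z\<^sup>2 u\<close> the flux \<open>Im (cnj u * u')\<close> has derivative \<open>- Im (z\<^sup>2) * \<bar>u\<bar>\<^sup>2\<close>.
  This is the only source of positivity for the kernel inequality below.
\<close>
lemma energy_decreasing:
  fixes z A B :: complex
  assumes z: "Im (z\<^sup>2) \<ge> 0" and b: "0 \<le> b"
  defines "u \<equiv> (\<lambda>t::real. A * cos (z * t) + B * sin (z * t))"
    and "v \<equiv> (\<lambda>t::real. z * (B * cos (z * t) - A * sin (z * t)))"
  shows "Im (cnj (u b) * v b) \<le> Im (cnj (u 0) * v 0)"
proof -
  have du: "(u has_vector_derivative v t) (at t)" for t
    unfolding u_def v_def
    by (auto intro!: derivative_eq_intros has_vector_derivative_real_field simp: algebra_simps)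
  have dv: "(v has_vector_derivative - (z\<^sup>2 * u t)) (at t)" for t
    unfolding u_def v_def
    by (auto intro!: derivative_eq_intros has_vector_derivative_real_field
        simp: algebra_simps power2_eq_square)
  have dcu: "((\<lambda>t. cnj (u t)) has_vector_derivative cnj (v t)) (at t)" for t
    by (rule bounded_linear.has_vector_derivative[OF bounded_linear_cnj du])
  have "((\<lambda>t. Im (cnj (u t) * v t)) has_vector_derivative
           Im (cnj (u t) * - (z\<^sup>2 * u t) + cnj (v t) * v t)) (at t)" for t
    by (rule bounded_linear.has_vector_derivative[OF bounded_linear_Im
          has_vector_derivative_mult[OF dcu dv]])
  moreover have "Im (cnj (u t) * - (z\<^sup>2 * u t) + cnj (v t) * v t) = - Im (z\<^sup>2) * (cmod (u t))\<^sup>2" for t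
  proof -
    have "cnj (u t) * - (z\<^sup>2 * u t) + cnj (v t) * v t
        = - z\<^sup>2 * of_real ((cmod (u t))\<^sup>2) + of_real ((cmod (v t))\<^sup>2)"
      by (subst (1 2) complex_norm_square) (simp add: mult_ac)
    thus ?thesis by simp
  qed
  ultimately have d: "((\<lambda>t. Im (cnj (u t) * v t)) has_real_derivative
      - Im (z\<^sup>2) * (cmod (u t))\<^sup>2) (at t)" for t
    by (simp add: has_real_derivative_iff_has_vector_derivative)
  show ?thesis
    by (rule DERIV_nonpos_imp_nonincreasing[OF b]) (use d z in \<open>force simp: mult_nonneg_nonneg\<close>)
qed

text \<open>
  Up to the factor \<open>- \<bar>z * sin z\<bar>\<^sup>2\<close>, the imaginary part of \<open>cos (z * s) / (z * sin z)\<close>. This quotient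
  is, up to sign, the Green function \<open>G(s, 1)\<close> of \<open>- u'' - z\<^sup>2 u\<close> on \<open>[0, 1]\<close> with Neumann
  boundary conditions.
\<close>
definition cos_kernel :: "complex \<Rightarrow> real \<Rightarrow> real" where
  "cos_kernel z s = Im (cnj (cos (z * s)) * z * sin z)"

text \<open>
  The resolvent identity expresses \<open>Im G(s, t)\<close> through the \<open>L\<^sup>2\<close> inner product of \<open>G(s, \<cdot>)\<close> and
  \<open>G(t, \<cdot>)\<close>. The inequality says that \<open>G(s, \<cdot>) - G(1, \<cdot>)\<close> has nonnegative norm; the diagonal term
  \<open>G(s, s)\<close> is the mean of \<open>G(1, 1)\<close> and \<open>G(2 s - 1, 1)\<close>, because
  \<open>2 cos (z s) cos (z (1 - s)) = cos z + cos (z (2 s - 1))\<close>. The difference solves the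
  differential equation on each side of \<open>s\<close>, so its norm is read off from the flux at the ends of
  \<open>[0, s]\<close> and of \<open>[s, 1]\<close>.
\<close>
lemma cos_kernel_doubling:
  assumes z: "Im (z\<^sup>2) \<ge> 0" and s: "0 \<le> s" "s \<le> 1"
  shows "cos_kernel z 1 - cos_kernel z (2 * s - 1) \<le> 4 * (cos_kernel z 1 - cos_kernel z s)"
proof -
  define C S c \<sigma> where "C = cos (z * s)" and "S = sin (z * s)"
    and "c = cos (z * (1 - s))" and "\<sigma> = sin (z * (1 - s))"
  have z1: "z = z * s + z * (1 - s)" and z2: "z * of_real (2 * s - 1) = z * s - z * (1 - s)"
    by (simp_all add: algebra_simps)
  have cosz: "cos z = C * c - S * \<sigma>" and sinz: "sin z = S * c + C * \<sigma>"
    unfolding C_def S_def c_def \<sigma>_def by (subst z1, simp add: cos_add sin_add)+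
  have cos2: "cos (z * of_real (2 * s - 1)) = C * c + S * \<sigma>"
    unfolding C_def S_def c_def \<sigma>_def z2 by (simp add: cos_diff)
  \<comment> \<open>Contribution of \<open>[0, s]\<close>, where the difference is \<open>cos (z t) * (c - 1)\<close>.\<close>
  have p1: "0 \<le> Im (cnj C * z * S)"
    using energy_decreasing[OF z s(1), of 1 0] by (simp add: C_def S_def mult_ac)
  \<comment> \<open>Contribution of \<open>[s, 1]\<close>, in the variable \<open>1 - t\<close>: values \<open>u\<close> and derivatives \<open>v\<close> of the
    difference at the two ends, \<open>0\<close> standing for \<open>t = 1\<close> and \<open>1\<close> for \<open>t = s\<close>.\<close>
  define u0 v0 u1 v1 where "u0 = C - (C * c - S * \<sigma>)" and "v0 = z * - (S * c + C * \<sigma>)"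
    and "u1 = C * (c - 1)" and "v1 = z * - (C * \<sigma> + S)"
  have pyth: "c * c + \<sigma> * \<sigma> = 1"
    by (simp add: c_def \<sigma>_def flip: power2_eq_square)
  have p2: "Im (cnj u1 * v1) \<le> Im (cnj u0 * v0)"
  proof -
    have u1: "(C - cos z) * cos (z * complex_of_real (1 - s))
        + - sin z * sin (z * complex_of_real (1 - s)) = C * c - C * (c * c + \<sigma> * \<sigma>)"
      unfolding cosz sinz c_def[symmetric] \<sigma>_def[symmetric] by (simp add: algebra_simps)
    have v1: "- sin z * cos (z * complex_of_real (1 - s))
        - (C - cos z) * sin (z * complex_of_real (1 - s)) = - (S * (c * c + \<sigma> * \<sigma>) + C * \<sigma>)"
      unfolding cosz sinz c_def[symmetric] \<sigma>_def[symmetric] by (simp add: algebra_simps)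
    have u0: "(C - cos z) * cos (z * complex_of_real 0) + - sin z * sin (z * complex_of_real 0) = u0"
      by (simp add: u0_def cosz)
    have v0: "z * (- sin z * cos (z * complex_of_real 0)
        - (C - cos z) * sin (z * complex_of_real 0)) = v0"
      by (simp add: v0_def sinz)
    have b: "0 \<le> 1 - s" using s by simp
    from energy_decreasing[OF z b, of "C - cos z" "- sin z"] show ?thesis
      unfolding u0 v0 u1 v1 pyth by (simp add: u1_def v1_def algebra_simps)
  qed
  have p1': "0 \<le> Im ((cnj c - 1) * (c - 1) * (cnj C * z * S))"
  proof -
    have "(cnj c - 1) * (c - 1) = of_real ((cmod (c - 1))\<^sup>2)"
      by (subst complex_norm_square) (simp add: mult_ac)
    thus ?thesis using p1 by simp
  qed
  define W where "W = z * sin z"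
  have k1: "cos_kernel z 1 = Im (cnj (C * c - S * \<sigma>) * W)"
    and ks: "cos_kernel z s = Im (cnj C * W)"
    and k2: "cos_kernel z (2 * s - 1) = Im (cnj (C * c + S * \<sigma>) * W)"
    unfolding cos_kernel_def cos2 W_def C_def[symmetric] of_real_1 mult_1_right
    by (simp_all only: cosz mult.assoc)
  have k12: "cos_kernel z 1 + cos_kernel z (2 * s - 1) = 2 * Im (cnj (C * c) * W)"
    unfolding k1 k2 by (simp add: algebra_simps)
  have uv0: "Im (cnj u0 * v0) = cos_kernel z 1 - cos_kernel z s"
    unfolding k1 ks u0_def v0_def W_def sinz by (simp add: algebra_simps)
  have "(cnj c - 1) * (c - 1) * (cnj C * z * S) - cnj u1 * v1 = (cnj (C * c) - cnj C) * W"
    unfolding u1_def v1_def W_def sinz by (simp add: algebra_simps)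
  hence uv1: "Im ((cnj c - 1) * (c - 1) * (cnj C * z * S)) - Im (cnj u1 * v1)
      = Im (cnj (C * c) * W) - cos_kernel z s"
    unfolding ks by (metis left_diff_distrib minus_complex.sel(2))
  have "4 * (cos_kernel z 1 - cos_kernel z s) - (cos_kernel z 1 - cos_kernel z (2 * s - 1))
      = 2 * (Im ((cnj c - 1) * (c - 1) * (cnj C * z * S))
            + (Im (cnj u0 * v0) - Im (cnj u1 * v1)))"
    using uv1 k12 unfolding uv0 by (simp add: algebra_simps)
  also have "\<dots> \<ge> 0"
    using p1' p2 by simp
  finally show ?thesis by simp
qed

text \<open>
  At a maximum point \<open>t\<close> of the even function \<open>cos_kernel z\<close> on \<open>[-1, 1]\<close>, the point \<open>2 * \<bar>t\<bar> - 1\<close> is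
  again in \<open>[-1, 1]\<close>, so the doubling inequality bounds the gap \<open>m\<close> between the value at \<open>1\<close> and the
  maximum by \<open>m \<le> 4 * m\<close>; hence \<open>m \<ge> 0\<close>.
\<close>
lemma cos_kernel_le:
  assumes z: "Im (z\<^sup>2) \<ge> 0" and s: "\<bar>s\<bar> \<le> 1"
  shows "cos_kernel z s \<le> cos_kernel z 1"
proof -
  have even: "cos_kernel z (- t) = cos_kernel z t" for t
    by (simp add: cos_kernel_def)
  have "continuous_on {-1..1} (cos_kernel z)"
    unfolding cos_kernel_def by (intro continuous_intros)
  then obtain t where t: "t \<in> {-1..1}" "\<And>r. r \<in> {-1..1} \<Longrightarrow> cos_kernel z r \<le> cos_kernel z t"
    using continuous_attains_sup[of "{-1..1::real}" "cos_kernel z"] by auto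
  have at: "cos_kernel z \<bar>t\<bar> = cos_kernel z t"
    using even[of t] by (cases "t \<ge> 0") auto
  have "cos_kernel z (2 * \<bar>t\<bar> - 1) \<le> cos_kernel z t"
    by (rule t(2)) (use t(1) in auto)
  moreover have "cos_kernel z 1 - cos_kernel z (2 * \<bar>t\<bar> - 1) \<le> 4 * (cos_kernel z 1 - cos_kernel z \<bar>t\<bar>)"
    by (rule cos_kernel_doubling[OF z]) (use t(1) in auto)
  ultimately have "cos_kernel z t \<le> cos_kernel z 1"
    unfolding at by (simp add: algebra_simps)
  moreover have "cos_kernel z s \<le> cos_kernel z t"
    by (rule t(2)) (use s in \<open>auto simp: abs_le_iff\<close>)
  ultimately show ?thesis by (rule order_trans[rotated])
qed

text \<open>
  The gap at \<open>s = 0\<close> is what a constant weight contributes. Its explicit form makes the positivity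
  strict and gives its size near the real axis.
\<close>
lemma cos_kernel_gap_0:
  "cos_kernel z 1 - cos_kernel z 0
     = (cosh (Im z) - cos (Re z)) * (Re z * sinh (Im z) - Im z * sin (Re z))"
proof -
  define x y c s C H where "x = Re z" and "y = Im z" and "c = cos x" and "s = sin x"
    and "C = cosh y" and "H = sinh y"
  have cs: "c * c + s * s = 1"
    by (simp add: c_def s_def flip: power2_eq_square)
  have CH: "C * C - H * H = 1"
    using cosh_square_eq[of y] by (simp add: C_def H_def power2_eq_square)
  have parts: "Re (sin z) = s * C" "Im (sin z) = c * H" "Re (cos z) = c * C" "Im (cos z) = - s * H"
    by (simp_all add: Re_sin Im_sin Re_cos Im_cos x_def y_def c_def s_def C_def H_def
        cosh_def sinh_def field_simps)
  have "cos_kernel z 1 - cos_kernel z 0 = Im ((cnj (cos z) - 1) * (z * sin z))"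
    by (simp add: cos_kernel_def algebra_simps)
  also have "\<dots> = (c * C - 1) * (x * (c * H) + y * (s * C)) + s * H * (x * (s * C) - y * (c * H))"
    by (simp add: parts x_def y_def)
  also have "\<dots> = x * C * H * (c * c + s * s) - x * c * H + y * c * s * (C * C - H * H) - y * s * C"
    by (simp add: algebra_simps)
  also have "\<dots> = (C - c) * (x * H - y * s)"
    unfolding cs CH by (simp add: algebra_simps)
  finally show ?thesis by (simp add: x_def y_def c_def s_def C_def H_def)
qed

section \<open>Sine transforms of increasing weights\<close>

lemma integral_sin_tail:
  fixes z :: complex
  assumes "z \<noteq> 0" "s \<le> 1"
  shows "((\<lambda>t. Im (sin (z * of_real t) * cnj (sin z))) has_integral
           (cos_kernel z 1 - cos_kernel z s) / (cmod z)\<^sup>2) {s..1}"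
proof -
  have d: "((\<lambda>w. - cos (z * w) / z) has_field_derivative sin (z * w)) (at w)" for w
    using assms(1) by (auto intro!: derivative_eq_intros)
  have "((\<lambda>t. sin (z * of_real t)) has_integral - cos (z * of_real 1) / z - - cos (z * of_real s) / z) {s..1}"
    by (rule fundamental_theorem_of_calculus[OF assms(2)])
       (rule has_vector_derivative_at_within, rule has_vector_derivative_real_field, rule d)
  hence "((\<lambda>t. sin (z * of_real t) * cnj (sin z)) has_integral
      (- cos (z * of_real 1) / z - - cos (z * of_real s) / z) * cnj (sin z)) {s..1}"
    by (rule has_integral_mult_left)
  hence "((\<lambda>t. Im (sin (z * of_real t) * cnj (sin z))) has_integral
      Im ((- cos (z * of_real 1) / z - - cos (z * of_real s) / z) * cnj (sin z))) {s..1}"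
    using has_integral_linear[OF _ bounded_linear_Im] by (simp only: o_def)
  moreover have "Im ((- cos (z * of_real 1) / z - - cos (z * of_real s) / z) * cnj (sin z))
      = (cos_kernel z 1 - cos_kernel z s) / (cmod z)\<^sup>2"
  proof -
    define w where "w = (cos (z * of_real s) - cos z) * cnj (z * sin z)"
    have "(- cos (z * of_real 1) / z - - cos (z * of_real s) / z) * cnj (sin z) = w / (z * cnj z)"
      using assms(1) by (simp add: w_def field_simps)
    also have "\<dots> = w / of_real ((cmod z)\<^sup>2)"
      by (simp only: complex_norm_square)
    finally have "Im ((- cos (z * of_real 1) / z - - cos (z * of_real s) / z) * cnj (sin z))
        = Im w / (cmod z)\<^sup>2"
      by (simp only: Im_divide_of_real)
    moreover have "cnj w = cnj (cos (z * of_real s)) * z * sin z - cnj (cos z) * z * sin z"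
      unfolding w_def complex_cnj_mult complex_cnj_cnj complex_cnj_diff by (simp only: algebra_simps)
    hence "- Im (cnj w) = cos_kernel z 1 - cos_kernel z s"
      by (simp only: cos_kernel_def of_real_1 mult_1_right minus_complex.sel minus_diff_eq)
    hence "Im w = cos_kernel z 1 - cos_kernel z s"
      by (simp only: cnj.sel minus_minus)
    ultimately show ?thesis by (simp only:)
  qed
  ultimately show ?thesis by (simp only:)
qed

text \<open>
  The right-hand side is the imaginary part of \<open>S / sin z\<close> times \<open>\<bar>sin z\<bar>\<^sup>2\<close>. In this form it is an
  integral of \<open>f\<close> against a real kernel, and the tail integrals of that kernel are the gaps
  of \<open>cos_kernel z\<close>.
\<close>
lemma Im_sine_transform_ge:
  fixes f :: "real \<Rightarrow> real" and z :: complex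
  assumes f: "f absolutely_integrable_on {0..1}" "0 \<le> f 0" "mono_on {0..<1} f"
    and z: "Re z > 0" "Im z > 0"
    and S: "((\<lambda>t. f t *\<^sub>R sin (z * of_real t)) has_integral S) {0..1}"
  shows "f 0 * ((cosh (Im z) - cos (Re z)) * (Re z * sinh (Im z) - Im z * sin (Re z)) / (cmod z)\<^sup>2)
           \<le> Im (S * cnj (sin z))"
proof -
  have z0: "z \<noteq> 0" and z2: "Im (z\<^sup>2) \<ge> 0"
    using z by (auto simp: power2_eq_square)
  define g where "g = (\<lambda>t::real. Im (sin (z * of_real t) * cnj (sin z)))"
  have "f 0 * integral {0..1} g \<le> integral {0..1} (\<lambda>t. f t * g t)"
  proof (rule integral_mono_weight_ge[OF f])
    show "continuous_on {0..1} g"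
      unfolding g_def by (intro continuous_intros)
    show "0 \<le> integral {s..1} g" if "s \<in> {0..1}" for s
      using integral_unique[OF integral_sin_tail[OF z0, of s]] cos_kernel_le[OF z2, of s] that
      by (simp add: g_def)
  qed
  moreover have "integral {0..1} g = (cos_kernel z 1 - cos_kernel z 0) / (cmod z)\<^sup>2"
    unfolding g_def by (rule integral_unique, rule integral_sin_tail) (use z0 in auto)
  moreover have "((\<lambda>t. Im (f t *\<^sub>R sin (z * of_real t) * cnj (sin z))) has_integral Im (S * cnj (sin z))) {0..1}"
    using has_integral_linear[OF has_integral_mult_left[OF S] bounded_linear_Im] by (simp only: o_def)
  hence "integral {0..1} (\<lambda>t. f t * g t) = Im (S * cnj (sin z))"
    unfolding g_def by (intro integral_unique) (simp only: mult_scaleR_left scaleR_complex.sel)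
  ultimately show ?thesis
    by (simp add: cos_kernel_gap_0)
qed

lemma x_le_sinh: "0 \<le> x \<Longrightarrow> x \<le> sinh (x::real)"
proof -
  assume "0 \<le> x"
  have d: "((\<lambda>t. sinh t - t) has_real_derivative cosh t - 1) (at t)" for t :: real
    by (auto intro!: derivative_eq_intros)
  have "sinh 0 - 0 \<le> sinh x - x"
    by (rule DERIV_nonneg_imp_nondecreasing[OF \<open>0 \<le> x\<close>])
       (intro exI conjI, rule d, simp add: cosh_real_ge_1)
  thus ?thesis by simp
qed

lemma sin_x_less_x: "0 < x \<Longrightarrow> sin x < (x::real)"
proof (cases "x \<le> 1")
  assume x: "0 < x" "x \<le> 1"
  have "sin x - x < sin 0 - 0"
  proof (rule DERIV_neg_imp_decreasing_open[OF x(1)])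
    fix t :: real assume t: "0 < t" "t < x"
    have "cos t < cos 0" using t x pi_gt3 by (intro cos_monotone_0_pi) auto
    thus "\<exists>y. ((\<lambda>x. sin x - x) has_real_derivative y) (at t) \<and> y < 0"
      by (intro exI[of _ "cos t - 1"]) (auto intro!: derivative_eq_intros)
  qed (auto intro!: continuous_intros)
  thus ?thesis by simp
next
  assume "\<not> x \<le> 1"
  hence "sin x \<le> 1" "1 < x" by simp_all
  thus ?thesis by (rule order.strict_trans1)
qed

lemma cos_kernel_gap_0_pos:
  fixes x y :: real
  assumes "x > 0" "y > 0"
  shows "(cosh y - cos x) * (x * sinh y - y * sin x) > 0"
proof (rule mult_pos_pos)
  have "cosh y > 1" using assms cosh_real_strict_mono[of 0 y] by simp
  thus "cosh y - cos x > 0" using cos_le_one[of x] by linarith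
  have "y * sin x < y * x" using assms sin_x_less_x[of x] by simp
  also have "\<dots> \<le> x * sinh y" using assms x_le_sinh[of y] by simp
  finally show "x * sinh y - y * sin x > 0" by simp
qed
lemma deriv_nonneg_of_right_nonneg:
  fixes q :: "real \<Rightarrow> real"
  assumes d: "(q has_real_derivative d) (at 0)" and "q 0 = 0" and pos: "\<And>y. y > 0 \<Longrightarrow> q y \<ge> 0"
  shows "d \<ge> 0"
proof (rule ccontr)
  assume "\<not> d \<ge> 0"
  hence "d < 0" by simp
  from DERIV_neg_dec_right[OF d this] obtain e where e: "e > 0" "\<And>h. 0 < h \<Longrightarrow> h < e \<Longrightarrow> q (0 + h) < q 0"
    by auto
  from e(2)[of "e / 2"] e(1) pos[of "e / 2"] assms(2) show False by simp
qed

text \<open>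
  On the real axis both sides of the inequality for sine transforms in the quadrant vanish.
  Comparing their derivatives along the vertical direction yields a bound for the Wronskian of
  \<open>S\<close> and \<open>sin\<close>.
\<close>
lemma wronskian_ge:
  fixes S :: "complex \<Rightarrow> complex" and x K :: real
  assumes S': "(S has_field_derivative D) (at (of_real x))" and real: "Im (S (of_real x)) = 0" and x: "x > 0"
    and ineq: "\<And>z. Re z = x \<Longrightarrow> Im z > 0 \<Longrightarrow>
      K * ((cosh (Im z) - cos (Re z)) * (Re z * sinh (Im z) - Im z * sin (Re z)) / (cmod z)\<^sup>2)
        \<le> Im (S z * cnj (sin z))"
  shows "K * ((1 - cos x) * (x - sin x) / x\<^sup>2) \<le> Re D * sin x - Re (S (of_real x)) * cos x"
proof -
  define Z where "Z = (\<lambda>w. of_real x + \<i> * w)"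
  have Z0: "Z (of_real 0) = of_real x" by (simp add: Z_def)
  have dZ: "(Z has_field_derivative \<i>) (at w)" for w
    unfolding Z_def by (auto intro!: derivative_eq_intros)
  have "((\<lambda>w. S (Z w)) has_field_derivative D * \<i>) (at (of_real 0))"
    by (rule DERIV_chain2[OF _ dZ]) (use S' Z0 in simp)
  hence vS: "((\<lambda>y. S (Z (of_real y))) has_vector_derivative D * \<i>) (at 0)"
    by (rule has_vector_derivative_real_field)
  have "((\<lambda>w. sin (Z w)) has_field_derivative cos (of_real x) * \<i>) (at (of_real 0))"
    by (rule DERIV_chain2[OF _ dZ]) (use Z0 in \<open>auto intro: DERIV_sin\<close>)
  hence "((\<lambda>y. sin (Z (of_real y))) has_vector_derivative cos (of_real x) * \<i>) (at 0)"
    by (rule has_vector_derivative_real_field)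
  hence vs: "((\<lambda>y. cnj (sin (Z (of_real y)))) has_vector_derivative cnj (cos (of_real x) * \<i>)) (at 0)"
    by (rule bounded_linear.has_vector_derivative[OF bounded_linear_cnj])
  define W where "W = Re D * sin x - Re (S (of_real x)) * cos x"
  have "((\<lambda>y. Im (S (Z (of_real y)) * cnj (sin (Z (of_real y))))) has_vector_derivative
      Im (S (Z (of_real 0)) * cnj (cos (of_real x) * \<i>) + D * \<i> * cnj (sin (Z (of_real 0))))) (at 0)"
    by (rule bounded_linear.has_vector_derivative[OF bounded_linear_Im has_vector_derivative_mult[OF vS vs]])
  moreover have "Im (S (Z (of_real 0)) * cnj (cos (of_real x) * \<i>) + D * \<i> * cnj (sin (Z (of_real 0)))) = W"
    unfolding Z0 W_def sin_of_real cos_of_real by simp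
  ultimately have dpsi: "((\<lambda>y. Im (S (Z (of_real y)) * cnj (sin (Z (of_real y))))) has_real_derivative W) (at 0)"
    by (simp only: has_real_derivative_iff_has_vector_derivative)
  define B where "B = (1 - cos x) * (x - sin x) / x\<^sup>2"
  have dH: "((\<lambda>y. (cosh y - cos x) * (x * sinh y - y * sin x) / (x\<^sup>2 + y\<^sup>2)) has_real_derivative B) (at 0)"
    unfolding B_def using x
    by (auto intro!: derivative_eq_intros simp: power2_eq_square divide_simps)
  have "0 \<le> W - K * B"
  proof (rule deriv_nonneg_of_right_nonneg)
    show "((\<lambda>y. Im (S (Z (of_real y)) * cnj (sin (Z (of_real y))))
      - K * ((cosh y - cos x) * (x * sinh y - y * sin x) / (x\<^sup>2 + y\<^sup>2))) has_real_derivative W - K * B) (at 0)"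
      by (intro DERIV_diff DERIV_cmult dpsi dH)
    show "Im (S (Z (of_real 0)) * cnj (sin (Z (of_real 0))))
      - K * ((cosh 0 - cos x) * (x * sinh 0 - 0 * sin x) / (x\<^sup>2 + 0\<^sup>2)) = 0"
      unfolding Z0 sin_of_real using real by simp
    fix y :: real assume y: "y > 0"
    have "Re (Z (of_real y)) = x" "Im (Z (of_real y)) = y" "(cmod (Z (of_real y)))\<^sup>2 = x\<^sup>2 + y\<^sup>2"
      by (simp_all add: Z_def cmod_power2)
    with ineq[of "Z (of_real y)"] y
    show "0 \<le> Im (S (Z (of_real y)) * cnj (sin (Z (of_real y))))
      - K * ((cosh y - cos x) * (x * sinh y - y * sin x) / (x\<^sup>2 + y\<^sup>2))"
      by (simp only: diff_ge_0_iff_ge)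
  qed
  thus ?thesis by (simp add: W_def B_def)
qed

text \<open>
  At a multiple of \<open>\<pi>\<close> the tail integrals of the kernel are \<open>(1 - (-1) ^ k * cos (k \<pi> s)) / (k \<pi>)\<close>,
  so the sign needs no complex argument.
\<close>
lemma sine_integral_at_pi_multiple_nonneg:
  fixes f :: "real \<Rightarrow> real"
  assumes f: "f absolutely_integrable_on {0..1}" "0 \<le> f 0" "mono_on {0..<1} f" and k: "k \<ge> 1"
  shows "0 \<le> (-1) ^ (k + 1) * integral {0..1} (\<lambda>t. f t * sin (real k * pi * t))"
proof -
  define a where "a = real k * pi"
  have a: "a > 0" using k by (simp add: a_def)
  have ca: "cos a = (-1) ^ k" by (simp add: a_def cos_npi)
  define g where "g = (\<lambda>t. (-1) ^ (k + 1) * sin (a * t))"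
  have tail: "integral {s..1} g = (1 - (-1) ^ k * cos (a * s)) / a" if "s \<le> 1" for s
  proof (rule integral_unique)
    have "(g has_integral (-1) ^ k * cos (a * 1) / a - (-1) ^ k * cos (a * s) / a) {s..1}"
    proof (rule fundamental_theorem_of_calculus[OF that])
      fix t
      have "((\<lambda>t. (-1) ^ k * cos (a * t) / a) has_real_derivative g t) (at t within {s..1})"
        unfolding g_def using a by (auto intro!: derivative_eq_intros)
      thus "((\<lambda>t. (-1) ^ k * cos (a * t) / a) has_vector_derivative g t) (at t within {s..1})"
        by (simp only: has_real_derivative_iff_has_vector_derivative)
    qed
    thus "(g has_integral (1 - (-1) ^ k * cos (a * s)) / a) {s..1}"
      by (simp add: ca diff_divide_distrib flip: power_add mult_2)
  qed
  have tail_nonneg: "0 \<le> integral {s..1} g" if "s \<le> 1" for s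
  proof -
    have "\<bar>(-1) ^ k * cos (a * s)\<bar> \<le> 1" by (simp add: abs_mult power_abs)
    thus ?thesis using a unfolding tail[OF that] by (intro divide_nonneg_pos) linarith+
  qed
  have "f 0 * integral {0..1} g \<le> integral {0..1} (\<lambda>t. f t * g t)"
  proof (rule integral_mono_weight_ge[OF f])
    show "continuous_on {0..1} g" unfolding g_def by (intro continuous_intros)
  qed (rule tail_nonneg, simp)
  moreover have "0 \<le> f 0 * integral {0..1} g"
    using f(2) tail_nonneg[of 0] by simp
  moreover have "(\<lambda>t. f t * g t) = (\<lambda>t. (-1) ^ (k + 1) * (f t * sin (real k * pi * t)))"
    by (simp add: g_def a_def fun_eq_iff)
  ultimately show ?thesis by (simp only: integral_mult_right)
qed

text \<open>
  A constant weight has vanishing sine transform at even multiples of \<open>\<pi>\<close>. The weight \<open>t\<^sup>2\<close>, a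
  small multiple of which can be split off, supplies the strict sign.
\<close>
lemma square_sine_integral_at_pi_multiple_pos:
  assumes k: "k \<ge> 1"
  shows "0 < (-1) ^ (k + 1) * integral {0..1} (\<lambda>t. t\<^sup>2 * sin (real k * pi * t))"
proof -
  define a where "a = real k * pi"
  have a2: "a > 2"
  proof -
    have "1 * pi \<le> real k * pi" by (rule mult_right_mono) (use k in auto)
    thus ?thesis using pi_gt3 unfolding a_def by linarith
  qed
  have ca: "cos a = (-1) ^ k" and sa: "sin a = 0" by (simp_all add: a_def cos_npi sin_npi)
  define P where "P = (\<lambda>t. 2 * cos (a * t) / a ^ 3 + 2 * t * sin (a * t) / a\<^sup>2 - t\<^sup>2 * cos (a * t) / a)"
  have "((\<lambda>t. t\<^sup>2 * sin (a * t)) has_integral P 1 - P 0) {0..1}"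
  proof (rule fundamental_theorem_of_calculus)
    fix t :: real
    have "(P has_real_derivative t\<^sup>2 * sin (a * t)) (at t within {0..1})"
      unfolding P_def using a2
      by (auto intro!: derivative_eq_intros simp: field_simps power2_eq_square power3_eq_cube)
    thus "(P has_vector_derivative t\<^sup>2 * sin (a * t)) (at t within {0..1})"
      by (simp only: has_real_derivative_iff_has_vector_derivative)
  qed simp
  moreover have "P 1 - P 0 = 2 * (-1) ^ k / a ^ 3 - 2 / a ^ 3 - (-1) ^ k / a"
    by (simp add: P_def ca sa)
  ultimately have I: "integral {0..1} (\<lambda>t. t\<^sup>2 * sin (real k * pi * t)) = 2 * (-1) ^ k / a ^ 3 - 2 / a ^ 3 - (-1) ^ k / a"
    by (simp add: a_def integral_unique)
  have "(-1) ^ (k + 1) * integral {0..1} (\<lambda>t. t\<^sup>2 * sin (real k * pi * t))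
      = 1 / a - 2 / a ^ 3 * (1 - (-1) ^ k)"
    unfolding I by (cases "even k") (simp_all add: algebra_simps)
  moreover have "1 / a - 2 / a ^ 3 * (1 - (-1) ^ k) \<ge> 1 / a - 2 / a ^ 3 * 2"
    using a2 by (intro diff_left_mono mult_left_mono) (cases "even k"; simp)+
  moreover have "1 / a - 2 / a ^ 3 * 2 > 0"
  proof -
    have "a * a > 2 * 2" using a2 by (intro mult_strict_mono) auto
    thus ?thesis using a2 by (simp add: field_simps power3_eq_cube)
  qed
  ultimately show ?thesis by linarith
qed

section \<open>Zeros of a sine transform\<close>

lemma cos_less_1_if_sin_nonzero:
  fixes x :: real
  assumes "sin x \<noteq> 0"
  shows "cos x < 1"
proof -
  have "cos x \<noteq> 1"
  proof
    assume "cos x = 1"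
    hence "(sin x)\<^sup>2 = 0" using sin_cos_squared_add[of x] by simp
    thus False using assms by simp
  qed
  thus ?thesis by (simp add: less_le)
qed

text \<open>
  Growth at least as fast as that of \<open>\<epsilon> * t\<^sup>2\<close> is a quantitative form of strict monotonicity: it
  says that \<open>f t - \<epsilon> * t\<^sup>2\<close> is still nondecreasing.
\<close>
locale growing_sine_weight =
  fixes f :: "real \<Rightarrow> real" and \<epsilon> :: real and S :: "complex \<Rightarrow> complex"
  assumes f: "f absolutely_integrable_on {0..1}" and f0: "f 0 > 0" and \<epsilon>: "\<epsilon> > 0"
    and growth: "\<And>s t. 0 \<le> s \<Longrightarrow> s \<le> t \<Longrightarrow> t < 1 \<Longrightarrow> \<epsilon> * (t\<^sup>2 - s\<^sup>2) \<le> f t - f s"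
    and S: "\<And>z. ((\<lambda>t. f t *\<^sub>R sin (z * of_real t)) has_integral S z) {0..1}"
    and hol: "S holomorphic_on UNIV"
begin

lemma weight_mono: "mono_on {0..<1} f"
proof (rule mono_onI)
  fix s t :: real assume st: "s \<in> {0..<1}" "t \<in> {0..<1}" "s \<le> t"
  have "0 \<le> \<epsilon> * (t\<^sup>2 - s\<^sup>2)" using st \<epsilon> by (intro mult_nonneg_nonneg) (auto intro: power_mono)
  thus "f s \<le> f t" using growth[of s t] st by auto
qed

lemma sine_transform_Im_pos:
  assumes z: "Re z > 0" "Im z > 0"
  shows "Im (S z * cnj (sin z)) > 0"
proof -
  have "0 < f 0 * ((cosh (Im z) - cos (Re z)) * (Re z * sinh (Im z) - Im z * sin (Re z)) / (cmod z)\<^sup>2)"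
    by (rule mult_pos_pos[OF f0 divide_pos_pos[OF cos_kernel_gap_0_pos[OF z]]]) (use z in auto)
  also have "\<dots> \<le> Im (S z * cnj (sin z))"
    by (rule Im_sine_transform_ge[OF f _ weight_mono z S]) (use f0 in simp)
  finally show ?thesis .
qed

lemma sine_transform_cnj: "S (cnj z) = cnj (S z)"
proof -
  have "((\<lambda>t. cnj (f t *\<^sub>R sin (z * of_real t))) has_integral cnj (S z)) {0..1}"
    using has_integral_linear[OF S bounded_linear_cnj] by (simp only: o_def)
  moreover have "cnj (f t *\<^sub>R sin (z * of_real t)) = f t *\<^sub>R sin (cnj z * of_real t)" for t
    by (simp add: scaleR_conv_of_real cnj_sin)
  ultimately show ?thesis
    using S[of "cnj z"] by (simp only: has_integral_unique)
qed

lemma sine_transform_of_real: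
  "S (of_real x) = of_real (integral {0..1} (\<lambda>t. f t * sin (x * t)))"
proof -
  have "Im (S (of_real x)) = 0"
    using sine_transform_cnj[of "of_real x"] by (simp add: complex_eq_iff)
  moreover have "((\<lambda>t. Re (f t *\<^sub>R sin (of_real x * of_real t))) has_integral Re (S (of_real x))) {0..1}"
    using has_integral_linear[OF S bounded_linear_Re] by (simp only: o_def)
  hence "((\<lambda>t. f t * sin (x * t)) has_integral Re (S (of_real x))) {0..1}"
    unfolding of_real_mult[symmetric] sin_of_real scaleR_complex.sel Re_complex_of_real .
  hence "integral {0..1} (\<lambda>t. f t * sin (x * t)) = Re (S (of_real x))"
    by (rule integral_unique)
  ultimately show ?thesis by (simp add: complex_eq_iff)
qed

lemma sine_transform_pos_up_to_pi:
  assumes x: "0 < x" "x \<le> pi"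
  shows "Re (S (of_real x)) > 0"
proof -
  have tail: "integral {s..1} (\<lambda>t. sin (x * t)) = (cos (x * s) - cos x) / x" if "s \<le> 1" for s
  proof (rule integral_unique)
    have "((\<lambda>t. sin (x * t)) has_integral - cos (x * 1) / x - - cos (x * s) / x) {s..1}"
    proof (rule fundamental_theorem_of_calculus[OF that])
      fix t
      have "((\<lambda>t. - cos (x * t) / x) has_real_derivative sin (x * t)) (at t within {s..1})"
        using x by (auto intro!: derivative_eq_intros)
      thus "((\<lambda>t. - cos (x * t) / x) has_vector_derivative sin (x * t)) (at t within {s..1})"
        by (simp only: has_real_derivative_iff_has_vector_derivative)
    qed
    thus "((\<lambda>t. sin (x * t)) has_integral (cos (x * s) - cos x) / x) {s..1}"
      by (simp add: diff_divide_distrib)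
  qed
  have "f 0 * integral {0..1} (\<lambda>t. sin (x * t)) \<le> integral {0..1} (\<lambda>t. f t * sin (x * t))"
  proof (rule integral_mono_weight_ge[OF f _ weight_mono])
    fix s :: real assume s: "s \<in> {0..1}"
    have "cos x \<le> cos (x * s)"
      using x s by (intro cos_monotone_0_pi_le) (auto simp: mult_left_le)
    thus "0 \<le> integral {s..1} (\<lambda>t. sin (x * t))"
      using x s by (simp add: tail)
  qed (use f0 in \<open>auto intro!: continuous_intros\<close>)
  moreover have "cos x < 1"
    using cos_monotone_0_pi[of 0 x] x by simp
  hence "0 < f 0 * integral {0..1} (\<lambda>t. sin (x * t))"
    using x f0 by (simp add: tail)
  ultimately show ?thesis by (simp add: sine_transform_of_real)
qed

lemma sine_transform_sign_at_pi_multiple: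
  assumes k: "k \<ge> 1"
  shows "(-1) ^ (k + 1) * Re (S (of_real (real k * pi))) > 0"
proof -
  define q where "q = (\<lambda>t. t\<^sup>2 * sin (real k * pi * t))"
  define g where "g = (\<lambda>t. f t - \<epsilon> * t\<^sup>2)"
  have "(\<lambda>t. \<epsilon> * t\<^sup>2) absolutely_integrable_on {0..1}"
    by (rule absolutely_integrable_continuous_real) (intro continuous_intros)
  hence "g absolutely_integrable_on {0..1}"
    unfolding g_def by (rule set_integral_diff(1)[OF f])
  moreover have "mono_on {0..<1} g"
    using growth by (intro mono_onI) (auto simp: g_def algebra_simps)
  moreover have "0 \<le> g 0" using f0 by (simp add: g_def)
  ultimately have "0 \<le> (-1) ^ (k + 1) * integral {0..1} (\<lambda>t. g t * sin (real k * pi * t))"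
    using sine_integral_at_pi_multiple_nonneg k by blast
  also have "integral {0..1} (\<lambda>t. g t * sin (real k * pi * t)) = Re (S (of_real (real k * pi))) - \<epsilon> * integral {0..1} q"
  proof -
    have "continuous_on {0..1} (\<lambda>t. sin (real k * pi * t))"
      by (intro continuous_intros)
    from absolutely_integrable_mult_continuous[OF f this]
    have i1: "(\<lambda>t. f t * sin (real k * pi * t)) integrable_on {0..1}"
      by (simp add: absolutely_integrable_on_def)
    have i2: "(\<lambda>t. \<epsilon> * q t) integrable_on {0..1}"
      unfolding q_def by (rule integrable_continuous_interval) (intro continuous_intros)
    have "integral {0..1} (\<lambda>t. f t * sin (real k * pi * t) - \<epsilon> * q t)
        = integral {0..1} (\<lambda>t. f t * sin (real k * pi * t)) - integral {0..1} (\<lambda>t. \<epsilon> * q t)"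
      by (rule Henstock_Kurzweil_Integration.integral_diff[OF i1 i2])
    moreover have "(\<lambda>t. g t * sin (real k * pi * t)) = (\<lambda>t. f t * sin (real k * pi * t) - \<epsilon> * q t)"
      by (simp add: g_def q_def fun_eq_iff left_diff_distrib)
    ultimately show ?thesis
      unfolding sine_transform_of_real Re_complex_of_real by (simp only: integral_mult_right)
  qed
  finally have "\<epsilon> * ((-1) ^ (k + 1) * integral {0..1} q) \<le> (-1) ^ (k + 1) * Re (S (of_real (real k * pi)))"
    by (simp add: algebra_simps)
  moreover have "0 < \<epsilon> * ((-1) ^ (k + 1) * integral {0..1} q)"
    using square_sine_integral_at_pi_multiple_pos[OF k] \<epsilon> unfolding q_def by (rule mult_pos_pos[rotated])
  ultimately show ?thesis by (rule order.strict_trans2[rotated])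
qed

lemma sine_transform_has_derivative: "(S has_field_derivative deriv S z) (at z)"
  using hol by (intro holomorphic_derivI[of _ UNIV]) auto

lemma sine_transform_wronskian_pos:
  assumes x: "x > 0" "sin x \<noteq> 0"
  shows "Re (deriv S (of_real x)) * sin x - Re (S (of_real x)) * cos x > 0"
proof -
  have "0 < f 0 * ((1 - cos x) * (x - sin x) / x\<^sup>2)"
    using f0 cos_less_1_if_sin_nonzero[OF x(2)] sin_x_less_x[OF x(1)] x(1)
    by (intro mult_pos_pos divide_pos_pos) auto
  also have "\<dots> \<le> Re (deriv S (of_real x)) * sin x - Re (S (of_real x)) * cos x"
  proof (rule wronskian_ge[OF sine_transform_has_derivative])
    show "Im (S (of_real x)) = 0" by (simp add: sine_transform_of_real)
    fix z assume "Re z = x" "Im z > 0"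
    thus "f 0 * ((cosh (Im z) - cos (Re z)) * (Re z * sinh (Im z) - Im z * sin (Re z)) / (cmod z)\<^sup>2)
        \<le> Im (S z * cnj (sin z))"
      using x f0 by (intro Im_sine_transform_ge[OF f _ weight_mono _ _ S]) auto
  qed (rule x)
  finally show ?thesis .
qed

lemma sine_transform_real_derivative:
  "((\<lambda>x. Re (S (of_real x))) has_real_derivative Re (deriv S (of_real x))) (at x)"
  using bounded_linear.has_vector_derivative[OF bounded_linear_Re
      has_vector_derivative_real_field[OF sine_transform_has_derivative]]
  by (simp only: has_real_derivative_iff_has_vector_derivative)

lemma sin_nonzero_between_pi_multiples:
  assumes "real k * pi < x" "x < (real k + 1) * pi"
  shows "sin x \<noteq> 0"
proof
  assume "sin x = 0"
  then obtain i :: int where i: "x = of_int i * pi" by (auto simp: sin_zero_iff_int2)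
  have "real k < of_int i" "of_int i < real k + 1" using assms unfolding i by auto
  hence "of_int (int k) < (of_int i :: real)" "of_int i < (of_int (int k + 1) :: real)" by simp_all
  thus False unfolding of_int_less_iff by simp
qed

text \<open>
  Existence comes from the alternating signs at the multiples of \<open>\<pi>\<close>, uniqueness from the
  Wronskian, which is the numerator of the derivative of \<open>S / sin\<close>.
\<close>
lemma sine_transform_ex1_zero:
  assumes k: "k \<ge> 1"
  shows "\<exists>!x. x \<in> {real k * pi<..<(real k + 1) * pi} \<and> S (of_real x) = 0"
proof (rule ex_ex1I)
  define R where "R = (\<lambda>x. Re (S (of_real x)))"
  have R0: "S (of_real x) = 0 \<longleftrightarrow> R x = 0" for x
    by (simp add: R_def sine_transform_of_real)
  have dR: "(R has_real_derivative Re (deriv S (of_real x))) (at x)" for x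
    unfolding R_def by (rule sine_transform_real_derivative)
  define g where "g = (\<lambda>x. (-1) ^ (k + 1) * R x)"
  have cont: "continuous_on A g" for A
    unfolding g_def
    by (intro continuous_intros) (meson DERIV_continuous_on dR has_field_derivative_at_within)
  have ga: "g (real k * pi) > 0"
    unfolding g_def R_def by (rule sine_transform_sign_at_pi_multiple[OF k])
  have gb: "g ((real k + 1) * pi) < 0"
    using sine_transform_sign_at_pi_multiple[of "k + 1"] by (simp add: g_def R_def add.commute)
  have "\<exists>x\<ge>real k * pi. x \<le> (real k + 1) * pi \<and> g x = 0"
    by (rule IVT2') (use ga gb cont in \<open>auto intro: less_imp_le simp: algebra_simps\<close>)
  then obtain x where x: "real k * pi \<le> x" "x \<le> (real k + 1) * pi" "g x = 0" by blast
  hence "x \<noteq> real k * pi" "x \<noteq> (real k + 1) * pi" using ga gb by auto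
  with x have "x \<in> {real k * pi<..<(real k + 1) * pi} \<and> S (of_real x) = 0"
    by (auto simp: R0 g_def)
  thus "\<exists>x. x \<in> {real k * pi<..<(real k + 1) * pi} \<and> S (of_real x) = 0" by blast
  have lt: False if uv: "real k * pi < u" "u < v" "v < (real k + 1) * pi" "R u = 0" "R v = 0" for u v
  proof -
    have "R u / sin u < R v / sin v"
    proof (rule DERIV_pos_imp_increasing[OF uv(2)])
      fix y assume y: "u \<le> y" "y \<le> v"
      have s: "sin y \<noteq> 0" by (rule sin_nonzero_between_pi_multiples[of k]) (use y uv in auto)
      have "0 \<le> real k * pi" by simp
      hence y0: "y > 0" using y uv by linarith
      define W where "W = Re (deriv S (of_real y)) * sin y - R y * cos y"
      have "((\<lambda>y. R y / sin y) has_real_derivative W / (sin y * sin y)) (at y)"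
        unfolding W_def by (rule DERIV_divide[OF dR DERIV_sin s])
      moreover have "W / (sin y * sin y) > 0"
        using sine_transform_wronskian_pos[OF y0 s] s
        by (intro divide_pos_pos) (auto simp: W_def R_def not_sum_squares_lt_zero zero_less_mult_iff linorder_neq_iff)
      ultimately show "\<exists>d. ((\<lambda>y. R y / sin y) has_real_derivative d) (at y) \<and> 0 < d" by blast
    qed
    thus False using uv by simp
  qed
  fix u v assume "u \<in> {real k * pi<..<(real k + 1) * pi} \<and> S (of_real u) = 0"
    "v \<in> {real k * pi<..<(real k + 1) * pi} \<and> S (of_real v) = 0"
  thus "u = v" using lt[of u v] lt[of v u] unfolding R0 by (cases u v rule: linorder_cases) auto
qed

lemma sine_transform_zeros:
  assumes z: "Re z > 0" "S z = 0"
  shows "Im z = 0" and "\<exists>k\<ge>1. real k * pi < Re z \<and> Re z < (real k + 1) * pi" and "deriv S z \<noteq> 0"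
proof -
  show Im: "Im z = 0"
  proof (rule ccontr)
    assume "Im z \<noteq> 0"
    then consider "Im z > 0" | "Im z < 0" by linarith
    thus False
    proof cases
      case 1
      thus False using sine_transform_Im_pos[OF z(1)] z(2) by simp
    next
      case 2
      thus False using sine_transform_Im_pos[of "cnj z"] z sine_transform_cnj[of z] by simp
    qed
  qed
  define x where "x = Re z"
  have zx: "z = of_real x" using Im by (simp add: x_def complex_eq_iff)
  have x0: "x > 0" using z by (simp add: x_def)
  have Rx: "Re (S (of_real x)) = 0" using z(2) zx by simp
  have xpi: "x > pi"
    using sine_transform_pos_up_to_pi[OF x0] Rx by (cases "x \<le> pi") auto
  define k where "k = nat \<lfloor>x / pi\<rfloor>"
  have "1 < x / pi" using xpi by simp
  hence k1: "k \<ge> 1" unfolding k_def by linarith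
  have kx: "real k \<le> x / pi" "x / pi < real k + 1"
    using x0 unfolding k_def by (simp_all add: of_nat_nat) 
  have kle: "real k * pi \<le> x" "x < (real k + 1) * pi"
    using kx by (simp_all add: field_simps)
  have "x \<noteq> real k * pi"
    using sine_transform_sign_at_pi_multiple[OF k1] Rx by auto
  with kle have kx': "real k * pi < x" "x < (real k + 1) * pi" by auto
  with k1 show "\<exists>k\<ge>1. real k * pi < Re z \<and> Re z < (real k + 1) * pi"
    unfolding x_def by blast
  have "sin x \<noteq> 0" by (rule sin_nonzero_between_pi_multiples[OF kx'])
  from sine_transform_wronskian_pos[OF x0 this] Rx show "deriv S z \<noteq> 0"
    unfolding zx by auto
qed

end

section \<open>Gauss sums with a negative product of the upper parameters\<close>

text \<open>The terms of the series \<open>\<^sub>2F\<^sub>1 (a, b; c; 1)\<close>.\<close>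
definition gauss_term :: "real \<Rightarrow> real \<Rightarrow> real \<Rightarrow> nat \<Rightarrow> real" where
  "gauss_term a b c m = pochhammer a m * pochhammer b m / (pochhammer c m * fact m)"

definition gauss_sum :: "real \<Rightarrow> real \<Rightarrow> real \<Rightarrow> real" where
  "gauss_sum a b c = (\<Sum>m. gauss_term a b c m)"

lemma gauss_term_0 [simp]: "gauss_term a b c 0 = 1"
  by (simp add: gauss_term_def)

lemma gauss_term_neg:
  assumes "a > -1" "b > -1" "a * b < 0" "c > 0"
  shows "gauss_term a b c (Suc m) < 0"
proof -
  have "gauss_term a b c (Suc m) = (a * b) * (pochhammer (a + 1) m * pochhammer (b + 1) m
      / (pochhammer c (Suc m) * fact (Suc m)))"
    by (simp add: gauss_term_def pochhammer_rec[of a] pochhammer_rec[of b])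
  also have "\<dots> < 0"
    by (rule mult_neg_pos[OF assms(3)], intro divide_pos_pos mult_pos_pos pochhammer_pos)
       (use assms in auto)
  finally show ?thesis .
qed

text \<open>
  Gauss' contiguous relation holds termwise up to the difference of the sequence \<open>R\<close>. The first
  form of this difference exhibits its sign, from which the convergence of the series follows; the
  second is the one to sum.
\<close>
lemma gauss_term_telescope:
  fixes a b c :: real
  assumes "c > 0"
  defines "R \<equiv> (\<lambda>m. - c * real m * gauss_term a b c m)"
  shows "R (Suc m) - R m = c * gauss_term a b c m / (c + real m) * (real m * (c - a - b) - a * b)"
    and "R (Suc m) - R m = c * (c - a - b) * gauss_term a b c m
            - (c - a) * (c - b) * gauss_term a b (c + 1) m"
proof -
  have cm: "c + real m > 0" using assms by simp
  have step: "real (Suc m) * gauss_term a b c (Suc m)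
      = gauss_term a b c m * (a + real m) * (b + real m) / (c + real m)"
    by (simp add: gauss_term_def pochhammer_Suc divide_inverse mult_ac)
  have shift: "gauss_term a b (c + 1) m = gauss_term a b c m * c / (c + real m)"
  proof -
    have "c * pochhammer (c + 1) m = pochhammer c m * (c + real m)"
      by (metis pochhammer_rec pochhammer_Suc)
    thus ?thesis
      using assms(1) cm pochhammer_pos[of c m] pochhammer_pos[of "c + 1" m]
      by (simp add: gauss_term_def divide_simps mult_ac)
  qed
  have "R (Suc m) = - c * (real (Suc m) * gauss_term a b c (Suc m))"
    by (simp add: R_def)
  hence R: "R (Suc m) - R m = - c * (gauss_term a b c m * (a + real m) * (b + real m) / (c + real m))
      + c * real m * gauss_term a b c m"
    unfolding step by (simp add: R_def)
  show 1: "R (Suc m) - R m = c * gauss_term a b c m / (c + real m) * (real m * (c - a - b) - a * b)"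
    unfolding R using cm by (simp add: divide_simps) (simp add: algebra_simps)
  show "R (Suc m) - R m = c * (c - a - b) * gauss_term a b c m
            - (c - a) * (c - b) * gauss_term a b (c + 1) m"
    unfolding 1 shift using cm by (simp add: divide_simps) (simp add: algebra_simps)
qed

text \<open>
  All terms but the first are negative, so \<open>R\<close> is nonnegative and decreases from index \<open>1\<close> on, and its total
  decrease dominates a multiple of the sum of the absolute values of the terms. The limit of \<open>R\<close> is
  zero, as otherwise the terms would be bounded below by a multiple of the harmonic series.
\<close>
lemma gauss_summable_lim:
  assumes ab: "a > -1" "b > -1" "a * b < 0" and c: "c > 0" "c - a - b > 0"
  shows "summable (gauss_term a b c)"
    and "(\<lambda>m. c * real m * gauss_term a b c m) \<longlonglongrightarrow> 0"
proof -
  define t where "t = gauss_term a b c"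
  define R where "R = (\<lambda>m. - c * real m * t m)"
  define \<kappa> where "\<kappa> = min (c - a - b) (- (a * b) / c)"
  have \<kappa>: "\<kappa> > 0"
    using assms unfolding \<kappa>_def by (intro min_less_iff_conj[THEN iffD2] conjI divide_pos_pos) auto
  have tneg: "t (Suc m) < 0" for m
    unfolding t_def by (rule gauss_term_neg) (use assms in auto)
  have step: "c * \<kappa> * - t (Suc m) \<le> R (Suc m) - R (Suc (Suc m))" for m
  proof -
    have "\<kappa> * (c + real (Suc m)) \<le> real (Suc m) * (c - a - b) - a * b"
    proof -
      have "\<kappa> * real (Suc m) \<le> (c - a - b) * real (Suc m)"
        by (intro mult_right_mono) (auto simp: \<kappa>_def)
      moreover have "\<kappa> * c \<le> - (a * b) / c * c"
        using c by (intro mult_right_mono) (auto simp: \<kappa>_def)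
      ultimately show ?thesis using c by (simp add: algebra_simps)
    qed
    hence "\<kappa> \<le> (real (Suc m) * (c - a - b) - a * b) / (c + real (Suc m))"
      using c by (subst pos_le_divide_eq) auto
    hence "(c * - t (Suc m)) * \<kappa>
        \<le> (c * - t (Suc m)) * ((real (Suc m) * (c - a - b) - a * b) / (c + real (Suc m)))"
      using c tneg[of m] by (intro mult_left_mono mult_nonneg_nonneg) auto
    also have "\<dots> = - (R (Suc (Suc m)) - R (Suc m))"
      unfolding R_def t_def gauss_term_telescope(1)[OF c(1)] by simp
    finally show ?thesis by (simp add: mult_ac)
  qed
  have Rpos: "0 \<le> R m" for m
    using tneg[of "m - 1"] c by (cases m) (auto simp: R_def mult_nonneg_nonpos)
  have part: "(\<Sum>m<n. c * \<kappa> * - t (Suc m)) \<le> R 1 - R (Suc n)" for n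
  proof (induction n)
    case (Suc n)
    show ?case using Suc.IH step[of n] by simp
  qed (simp add: R_def)
  have "summable (\<lambda>m. c * \<kappa> * - t (Suc m))"
  proof (rule summableI_nonneg_bounded)
    show "0 \<le> c * \<kappa> * - t (Suc m)" for m
      using c \<kappa> tneg[of m] by (intro mult_nonneg_nonneg) auto
    show "(\<Sum>m<n. c * \<kappa> * - t (Suc m)) \<le> R 1" for n
      using part[of n] Rpos[of "Suc n"] by linarith
  qed
  hence "summable (\<lambda>m. t (Suc m))"
    using c \<kappa> by (simp add: summable_cmult_iff summable_minus_iff)
  hence sumt: "summable t" by (simp add: summable_Suc_iff)
  thus "summable (gauss_term a b c)" by (simp add: t_def)
  have dec: "R (Suc (Suc m)) \<le> R (Suc m)" for m
    using step[of m] c \<kappa> tneg[of m] by (smt (verit) mult_nonneg_nonneg mult_pos_pos)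
  hence "decseq (\<lambda>m. R (Suc m))" by (rule decseq_SucI)
  then obtain L where L: "(\<lambda>m. R (Suc m)) \<longlonglongrightarrow> L" "\<And>m. L \<le> R (Suc m)"
    using decseq_convergent[of "\<lambda>m. R (Suc m)" 0] Rpos by blast
  have "L = 0"
  proof (rule ccontr)
    assume "L \<noteq> 0"
    moreover have "L \<ge> 0" by (rule LIMSEQ_le_const[OF L(1)]) (use Rpos in auto)
    ultimately have Lpos: "L > 0" by simp
    have "summable (\<lambda>m. (c / L) * - t (Suc m))"
      by (intro summable_mult summable_minus) (use sumt in \<open>simp add: summable_Suc_iff\<close>)
    hence "summable (\<lambda>m. 1 / real (Suc m))"
    proof (rule summable_comparison_test')
      fix m :: nat
      have "L \<le> real (Suc m) * (c * - t (Suc m))"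
        using L(2)[of m] by (simp add: R_def algebra_simps)
      hence "1 \<le> real (Suc m) * ((c / L) * - t (Suc m))"
        using Lpos by (simp add: field_simps)
      thus "norm (1 / real (Suc m)) \<le> (c / L) * - t (Suc m)"
        by (simp add: field_simps del: of_nat_Suc)
    qed
    thus False
      using not_summable_harmonic[where 'a = real] by (simp add: summable_Suc_iff[of "\<lambda>n. inverse (real n)"] divide_inverse del: of_nat_Suc)
  qed
  hence "R \<longlonglongrightarrow> 0" using L(1) by (simp add: filterlim_sequentially_Suc)
  hence "(\<lambda>m. - R m) \<longlonglongrightarrow> - 0" by (rule tendsto_minus)
  thus "(\<lambda>m. c * real m * gauss_term a b c m) \<longlonglongrightarrow> 0"
    by (simp add: R_def t_def)
qed

lemma gauss_sum_rec:
  assumes ab: "a > -1" "b > -1" "a * b < 0" and c: "c > 0" "c - a - b > 0"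
  shows "c * (c - a - b) * gauss_sum a b c = (c - a) * (c - b) * gauss_sum a b (c + 1)"
proof -
  have s1: "gauss_term a b c sums gauss_sum a b c"
    unfolding gauss_sum_def by (intro summable_sums gauss_summable_lim assms)
  have s2: "gauss_term a b (c + 1) sums gauss_sum a b (c + 1)"
    unfolding gauss_sum_def by (intro summable_sums gauss_summable_lim) (use assms in auto)
  have "(\<lambda>m. - c * real m * gauss_term a b c m) \<longlonglongrightarrow> - 0"
    using tendsto_minus[OF gauss_summable_lim(2)[OF assms]] by simp
  from telescope_sums[OF this]
  have "(\<lambda>m. c * (c - a - b) * gauss_term a b c m - (c - a) * (c - b) * gauss_term a b (c + 1) m) sums 0"
    unfolding gauss_term_telescope(2)[OF c(1)] by simp
  moreover have "(\<lambda>m. c * (c - a - b) * gauss_term a b c m - (c - a) * (c - b) * gauss_term a b (c + 1) m)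
     sums (c * (c - a - b) * gauss_sum a b c - (c - a) * (c - b) * gauss_sum a b (c + 1))"
    by (intro sums_diff sums_mult s1 s2)
  ultimately have "c * (c - a - b) * gauss_sum a b c - (c - a) * (c - b) * gauss_sum a b (c + 1) = 0"
    by (rule sums_unique2[symmetric])
  thus ?thesis by simp
qed

lemma pochhammer_mono:
  fixes x y :: real
  assumes "0 < x" "x \<le> y"
  shows "pochhammer x n \<le> pochhammer y n"
  unfolding pochhammer_prod using assms by (intro prod_mono) auto

text \<open>
  Raising \<open>c\<close> to \<open>c + n\<close> shrinks each negative term by at least the factor \<open>c / (c + n)\<close>, so the
  sum is positive for large \<open>n\<close>. The recursion has positive coefficients and carries the sign back
  to \<open>n = 0\<close>.
\<close>
lemma gauss_sum_pos:
  assumes ab: "a > -1" "b > -1" "a * b < 0"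
    and c: "c > 0" "c - a - b > 0" "c > a" "c > b"
  shows "gauss_sum a b c > 0"
proof -
  define t where "t = gauss_term a b"
  have sm: "summable (\<lambda>m. - t (c + real n) (Suc m))" for n
    unfolding t_def by (intro summable_minus, subst summable_Suc_iff, rule gauss_summable_lim)
      (use assms in auto)
  have G: "gauss_sum a b (c + real n) = 1 - (\<Sum>m. - t (c + real n) (Suc m))" for n
  proof -
    have "summable (t (c + real n))"
      unfolding t_def by (rule gauss_summable_lim) (use assms in auto)
    from suminf_split_head[OF this] suminf_minus[of "\<lambda>m. t (c + real n) (Suc m)"] show ?thesis
      using sm[of n] by (simp add: gauss_sum_def t_def summable_minus_iff)
  qed
  \<comment> \<open>The summand \<open>real 0\<close> keeps \<open>D\<close> an instance of the facts about \<open>c + real n\<close>.\<close>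
  define D where "D = (\<Sum>m. - t (c + real 0) (Suc m))"
  have le: "- t (c + real n) (Suc m) \<le> c / (c + real n) * - t (c + real 0) (Suc m)" for n m
  proof -
    have cn: "c + real n > 0" using c by simp
    define A where "A = - (pochhammer a (Suc m) * pochhammer b (Suc m)) / fact (Suc m)"
    have A: "A > 0"
    proof -
      have "- t 1 (Suc m) > 0"
        unfolding t_def using gauss_term_neg[OF ab, of 1 m] by simp
      moreover have "- t 1 (Suc m) = A / pochhammer 1 (Suc m)"
        by (simp add: t_def gauss_term_def A_def)
      ultimately show ?thesis
        using pochhammer_pos[of "1::real" "Suc m"] by (simp add: zero_less_divide_iff)
    qed
    have e: "- t d (Suc m) = A / (d * pochhammer (d + 1) m)" for d
      by (simp add: t_def gauss_term_def A_def pochhammer_rec[of d])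
    have "A / ((c + real n) * pochhammer (c + real n + 1) m) \<le> A / ((c + real n) * pochhammer (c + 1) m)"
      using A cn c by (intro divide_left_mono mult_left_mono mult_pos_pos pochhammer_mono pochhammer_pos) auto
    also have "\<dots> = c / (c + real n) * (A / (c * pochhammer (c + 1) m))"
      using c by simp
    finally show ?thesis unfolding e by simp
  qed
  have "(\<Sum>m. - t (c + real n) (Suc m)) \<le> c / (c + real n) * D" for n
    unfolding D_def suminf_mult[OF sm[of 0], symmetric]
    by (rule suminf_le[OF le sm[of n] summable_mult[OF sm[of 0]]])
  hence D: "1 - gauss_sum a b (c + real n) \<le> c / (c + real n) * D" for n
    unfolding G by simp
  obtain n :: nat where n: "c * D < real n" using reals_Archimedean2 by blast
  have "c * D < c + real n" using n c by linarith
  hence "c / (c + real n) * D < 1"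
    using c by (simp add: field_simps)
  hence pos: "gauss_sum a b (c + real n) > 0" using D[of n] by linarith
  have down: "gauss_sum a b d > 0" if "d \<ge> c" "gauss_sum a b (d + 1) > 0" for d
  proof -
    have "d * (d - a - b) * gauss_sum a b d > 0"
      unfolding gauss_sum_rec[OF ab, of d]
      using that c by (subst gauss_sum_rec[OF ab]) (auto intro!: mult_pos_pos)
    moreover have "d * (d - a - b) > 0" using that c by (intro mult_pos_pos) auto
    ultimately show ?thesis by (simp add: zero_less_mult_iff)
  qed
  have "gauss_sum a b (c + real (n - k)) > 0" if "k \<le> n" for k
    using that
  proof (induction k)
    case (Suc k)
    show ?case
    proof (rule down)
      have "c + real (n - Suc k) + 1 = c + real (n - k)"
        using Suc.prems by (simp add: of_nat_diff)
      thus "gauss_sum a b (c + real (n - Suc k) + 1) > 0" using Suc by simp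
    qed simp
  qed (use pos in simp)
  from this[of n] show ?thesis by simp
qed

section \<open>A weight with hypergeometric moments\<close>

text \<open>
  Dominated convergence in the form used twice below: to integrate the hypergeometric series
  against \<open>(1 - t\<^sup>2) powr (c - 1) * t ^ (2 * n + 1)\<close>, and the sine series against the resulting weight.
\<close>
lemma weighted_series_integral:
  fixes p :: "real \<Rightarrow> real" and a :: "nat \<Rightarrow> real \<Rightarrow> 'a::euclidean_space"
  assumes p: "p integrable_on S" "\<And>t. t \<in> S \<Longrightarrow> 0 \<le> p t"
    and a: "\<And>n. ((\<lambda>t. p t *\<^sub>R a n t) has_integral y n) S"
    and bound: "\<And>n t. t \<in> S \<Longrightarrow> norm (a n t) \<le> C n" "summable C"
  shows "(\<lambda>t. p t *\<^sub>R (\<Sum>n. a n t)) integrable_on S"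
    and "y sums integral S (\<lambda>t. p t *\<^sub>R (\<Sum>n. a n t))"
proof -
  define f where "f = (\<lambda>k t. p t *\<^sub>R (\<Sum>n<k. a n t))"
  have f: "(f k has_integral (\<Sum>n<k. y n)) S" for k
    unfolding f_def scaleR_sum_right by (intro has_integral_sum a) auto
  have sa: "summable (\<lambda>n. norm (a n t))" if "t \<in> S" for t
    by (rule summable_comparison_test'[OF bound(2), of 0]) (use bound(1)[OF that] in auto)
  have C0: "0 \<le> C n" if "t \<in> S" for n t
    using bound(1)[OF that] norm_ge_zero order_trans by blast
  have le: "norm (f k t) \<le> p t * suminf C" if "t \<in> S" for k t
  proof -
    have "norm (\<Sum>n<k. a n t) \<le> (\<Sum>n<k. C n)"
      by (rule order_trans[OF norm_sum sum_mono]) (use bound(1)[OF that] in auto)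
    also have "\<dots> \<le> suminf C"
      by (rule sum_le_suminf[OF bound(2)]) (use C0[OF that] in auto)
    finally show ?thesis
      using p(2)[OF that] by (simp add: f_def mult_left_mono)
  qed
  have lim: "(\<lambda>k. f k t) \<longlonglongrightarrow> p t *\<^sub>R (\<Sum>n. a n t)" if "t \<in> S" for t
    unfolding f_def
    by (intro tendsto_intros summable_LIMSEQ summable_norm_cancel[OF sa[OF that]])
  have fi: "\<And>k. f k integrable_on S" using f by blast
  have hi: "(\<lambda>t. p t * suminf C) integrable_on S"
    by (rule integrable_on_mult_left[OF p(1)])
  note dc = dominated_convergence[OF fi hi le lim]
  show "(\<lambda>t. p t *\<^sub>R (\<Sum>n. a n t)) integrable_on S"
    by (rule dc(1))
  show "y sums integral S (\<lambda>t. p t *\<^sub>R (\<Sum>n. a n t))"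
    using dc(2) unfolding sums_def integral_unique[OF f] .
qed

text \<open>
  Half the Beta integral \<open>B (n + 1, c)\<close> after the substitution \<open>u = t\<^sup>2\<close>. The induction on \<open>n\<close> writes
  \<open>t\<^sup>2 = 1 - (1 - t\<^sup>2)\<close>, which trades a power of \<open>t\<close> for a shift of \<open>c\<close>.
\<close>
lemma has_integral_one_minus_square_moment:
  fixes c :: real
  assumes "c > 0"
  shows "((\<lambda>t. (1 - t\<^sup>2) powr (c - 1) * t ^ (2 * n + 1)) has_integral
            fact n / (2 * pochhammer c (Suc n))) {0..1}"
  using assms
proof (induction n arbitrary: c)
  case (0 c)
  define P where "P = (\<lambda>t::real. - ((1 - t\<^sup>2) powr c / (2 * c)))"
  have "((\<lambda>t. (1 - t\<^sup>2) powr (c - 1) * t) has_integral P 1 - P 0) {0..1}"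
  proof (rule fundamental_theorem_of_calculus_interior)
    show "continuous_on {0..1} P"
      unfolding P_def using 0
      by (intro continuous_intros continuous_on_powr') (auto simp: power_le_one)
    fix t :: real assume t: "t \<in> {0<..<1}"
    hence "t\<^sup>2 < 1" by (simp add: power_less_one_iff abs_square_less_1)
    hence "(P has_real_derivative (1 - t\<^sup>2) powr (c - 1) * t) (at t)"
      unfolding P_def using 0 by (auto intro!: derivative_eq_intros simp: powr_diff field_simps)
    thus "(P has_vector_derivative (1 - t\<^sup>2) powr (c - 1) * t) (at t)"
      by (simp add: has_real_derivative_iff_has_vector_derivative)
  qed auto
  thus ?case by (simp add: P_def)
next
  case (Suc n c)
  have "((\<lambda>t. (1 - t\<^sup>2) powr (c - 1) * t ^ (2 * n + 1) - (1 - t\<^sup>2) powr (c + 1 - 1) * t ^ (2 * n + 1))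
     has_integral fact n / (2 * pochhammer c (Suc n)) - fact n / (2 * pochhammer (c + 1) (Suc n))) {0..1}"
    by (intro has_integral_diff Suc.IH) (use Suc.prems in auto)
  also have "fact n / (2 * pochhammer c (Suc n)) - fact n / (2 * pochhammer (c + 1) (Suc n))
      = fact (Suc n) / (2 * pochhammer c (Suc (Suc n)))"
  proof -
    have 1: "pochhammer c (Suc (Suc n)) = pochhammer c (Suc n) * (c + real (Suc n))"
      by (rule pochhammer_Suc)
    have 2: "pochhammer c (Suc (Suc n)) = c * pochhammer (c + 1) (Suc n)"
      by (rule pochhammer_rec)
    define X Y Z where "X = pochhammer c (Suc n)" and "Y = pochhammer (c + 1) (Suc n)"
      and "Z = pochhammer c (Suc (Suc n))"
    have "X > 0" "Y > 0" "Z > 0" unfolding X_def Y_def Z_def using Suc.prems by (auto intro!: pochhammer_pos)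
    hence "1 / X = (c + real (Suc n)) / Z" "1 / Y = c / Z"
      using 1 2 unfolding X_def[symmetric] Y_def[symmetric] Z_def[symmetric] using Suc.prems
      by (auto simp: field_simps)
    hence "fact n / 2 * (1 / X - 1 / Y) = fact n / 2 * (real (Suc n) / Z)"
      by (simp add: diff_divide_distrib[symmetric])
    moreover have "fact n / (2 * X) - fact n / (2 * Y) = fact n / 2 * (1 / X - 1 / Y)"
      by (simp add: right_diff_distrib)
    ultimately show ?thesis unfolding X_def[symmetric] Y_def[symmetric] Z_def[symmetric]
      by (simp add: mult.commute)
  qed
  finally show ?case
  proof (rule has_integral_eq[rotated])
    fix t :: real assume "t \<in> {0..1}"
    hence "1 - t\<^sup>2 \<ge> 0" by (simp add: power_le_one)
    hence eq: "(1 - t\<^sup>2) powr (c + 1 - 1) = (1 - t\<^sup>2) powr (c - 1) * (1 - t\<^sup>2)"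
      using powr_add[of "1 - t\<^sup>2" "c - 1" 1] by simp
    define X where "X = (1 - t\<^sup>2) powr (c - 1)"
    thus "(1 - t\<^sup>2) powr (c - 1) * t ^ (2 * n + 1) - (1 - t\<^sup>2) powr (c + 1 - 1) * t ^ (2 * n + 1)
        = (1 - t\<^sup>2) powr (c - 1) * t ^ (2 * Suc n + 1)"
      unfolding eq X_def[symmetric] by (simp add: algebra_simps power2_eq_square)
  qed
qed

lemma one_minus_square_powr_integrable:
  fixes c :: real
  assumes "c > 0"
  shows "(\<lambda>t. (1 - t\<^sup>2) powr (c - 1)) integrable_on {0..1}"
proof -
  define P where "P = (\<lambda>t::real. - ((1 - t) powr c / c))"
  have "((\<lambda>t. (1 - t) powr (c - 1)) has_integral P 1 - P 0) {0..1}"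
  proof (rule fundamental_theorem_of_calculus_interior)
    show "continuous_on {0..1} P"
      unfolding P_def using assms by (intro continuous_intros continuous_on_powr') auto
    fix t :: real assume t: "t \<in> {0<..<1}"
    hence "(P has_real_derivative (1 - t) powr (c - 1)) (at t)"
      unfolding P_def using assms by (auto intro!: derivative_eq_intros simp: powr_diff field_simps)
    thus "(P has_vector_derivative (1 - t) powr (c - 1)) (at t)"
      by (simp add: has_real_derivative_iff_has_vector_derivative)
  qed auto
  hence "(\<lambda>t. (1 - t) powr (c - 1)) absolutely_integrable_on {0..1}"
    by (intro nonnegative_absolutely_integrable_1) auto
  hence "(\<lambda>t. (1 - t) powr (c - 1) *\<^sub>R (1 + t) powr (c - 1)) absolutely_integrable_on {0..1}"
    by (rule absolutely_integrable_mult_continuous) (auto intro!: continuous_intros)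
  hence "(\<lambda>t. (1 - t) powr (c - 1) * (1 + t) powr (c - 1)) integrable_on {0..1}"
    by (simp add: absolutely_integrable_on_def)
  thus ?thesis
    by (rule integrable_eq)
       (auto simp: powr_mult[symmetric] algebra_simps power2_eq_square)
qed

text \<open>
  The weight that represents the Lommel function \<open>s\<^bsub>\<mu>,\<nu>\<^esub>\<close> as a sine transform, up to a power of the
  variable and a constant, when \<open>a = (\<mu> + \<nu>)/2\<close>, \<open>b = (\<mu> - \<nu>)/2\<close> and \<open>c = \<mu> + 1/2\<close>.
\<close>
definition lommel_weight :: "real \<Rightarrow> real \<Rightarrow> real \<Rightarrow> real \<Rightarrow> real" where
  "lommel_weight a b c t = (1 - t\<^sup>2) powr (c - 1) * (\<Sum>m. gauss_term a b c m * (1 - t\<^sup>2) ^ m)"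

definition lommel_moment :: "real \<Rightarrow> real \<Rightarrow> real \<Rightarrow> nat \<Rightarrow> real" where
  "lommel_moment a b c n = fact n / (2 * pochhammer c (Suc n)) * gauss_sum a b (c + real (Suc n))"

lemma lommel_weight_0: "lommel_weight a b c 0 = gauss_sum a b c"
  by (simp add: lommel_weight_def gauss_sum_def)

locale lommel_parameters =
  fixes a b c :: real
  assumes ab: "a > -1" "b > -1" "a * b < 0"
    and c: "0 < c" "c < 1" "c - a - b > 0" "c > a" "c > b"
begin

lemma gauss_term_abs_summable: "summable (\<lambda>m. \<bar>gauss_term a b c m\<bar>)"
proof -
  have "summable (\<lambda>m. - gauss_term a b c (Suc m))"
    using gauss_summable_lim(1)[OF ab c(1,3)] by (intro summable_minus) (simp add: summable_Suc_iff)
  hence "summable (\<lambda>m. \<bar>gauss_term a b c (Suc m)\<bar>)"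
    using gauss_term_neg[OF ab c(1)] by (simp add: abs_of_neg)
  thus ?thesis by (simp add: summable_Suc_iff[of "\<lambda>m. \<bar>gauss_term a b c m\<bar>"])
qed

lemma gauss_term_power_le:
  assumes "0 \<le> u" "u \<le> 1"
  shows "norm (gauss_term a b c m * u ^ m) \<le> \<bar>gauss_term a b c m\<bar>"
  using assms by (simp add: abs_mult mult_left_le power_le_one)

lemma gauss_term_power_summable:
  assumes "0 \<le> u" "u \<le> 1"
  shows "summable (\<lambda>m. gauss_term a b c m * u ^ m)"
  by (rule summable_comparison_test'[OF gauss_term_abs_summable]) (rule gauss_term_power_le[OF assms])

lemma gauss_series_antimono:
  assumes "0 \<le> u" "u \<le> v" "v \<le> 1"
  shows "(\<Sum>m. gauss_term a b c m * v ^ m) \<le> (\<Sum>m. gauss_term a b c m * u ^ m)"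
proof (rule suminf_le)
  show "gauss_term a b c m * v ^ m \<le> gauss_term a b c m * u ^ m" for m
    using gauss_term_neg[OF ab c(1), of "m - 1"] assms
    by (cases m) (auto simp del: power_Suc intro!: mult_left_mono_neg power_mono)
qed (intro gauss_term_power_summable; use assms in auto)+

lemma gauss_series_ge:
  assumes "0 \<le> u" "u \<le> 1"
  shows "gauss_sum a b c \<le> (\<Sum>m. gauss_term a b c m * u ^ m)"
  using gauss_series_antimono[of u 1] assms by (simp add: gauss_sum_def)

text \<open>
  Both factors of the weight increase with \<open>t\<close>: the series because its nonconstant coefficients are
  negative, the power because \<open>c < 1\<close>. The lower bound keeps the growth of the power, which
  exceeds that of \<open>(1 - c) * t\<^sup>2\<close>, and bounds the series below by its value at \<open>t = 0\<close>.
\<close>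
lemma lommel_weight_growth:
  assumes "0 \<le> s" "s \<le> t" "t < 1"
  shows "gauss_sum a b c * (1 - c) * (t\<^sup>2 - s\<^sup>2) \<le> lommel_weight a b c t - lommel_weight a b c s"
proof -
  define E where "E = (\<lambda>u. \<Sum>m. gauss_term a b c m * u ^ m)"
  define p where "p = (\<lambda>t::real. (1 - t\<^sup>2) powr (c - 1))"
  have G: "gauss_sum a b c > 0" by (rule gauss_sum_pos) (use ab c in auto)
  have sq: "s\<^sup>2 \<le> t\<^sup>2" "t\<^sup>2 < 1"
    using assms by (auto intro!: power_mono simp: power_less_one_iff abs_square_less_1)
  have "p s - (1 - c) * s\<^sup>2 \<le> p t - (1 - c) * t\<^sup>2"
  proof (rule DERIV_nonneg_imp_nondecreasing[OF assms(2)])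
    fix x assume x: "s \<le> x" "x \<le> t"
    have x2: "x\<^sup>2 < 1" using x assms by (simp add: power_less_one_iff abs_square_less_1)
    have d: "((\<lambda>x. p x - (1 - c) * x\<^sup>2) has_real_derivative
        2 * x * (1 - c) * ((1 - x\<^sup>2) powr (c - 2) - 1)) (at x)"
    proof -
      have "((\<lambda>x. 1 - x\<^sup>2) has_real_derivative - 2 * x) (at x)"
        by (auto intro!: derivative_eq_intros)
      moreover have "((\<lambda>u. u powr (c - 1)) has_real_derivative (c - 1) * (1 - x\<^sup>2) powr (c - 1 - 1)) (at (1 - x\<^sup>2))"
        by (rule has_real_derivative_powr) (use x2 in simp)
      ultimately have "(p has_real_derivative (c - 1) * (1 - x\<^sup>2) powr (c - 1 - 1) * (- 2 * x)) (at x)"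
        unfolding p_def by (rule DERIV_chain2[rotated])
      thus ?thesis
        by (auto intro!: derivative_eq_intros simp: algebra_simps)
    qed
    have "1 \<le> (1 - x\<^sup>2) powr (c - 2)"
    proof -
      have "(1 - x\<^sup>2) powr 0 \<le> (1 - x\<^sup>2) powr (c - 2)"
        by (rule powr_mono') (use c x2 in auto)
      thus ?thesis using x2 by simp
    qed
    hence "0 \<le> 2 * x * (1 - c) * ((1 - x\<^sup>2) powr (c - 2) - 1)"
      using x assms c by (intro mult_nonneg_nonneg) auto
    with d show "\<exists>y. ((\<lambda>x. p x - (1 - c) * x\<^sup>2) has_real_derivative y) (at x) \<and> 0 \<le> y" by blast
  qed
  hence p: "(1 - c) * (t\<^sup>2 - s\<^sup>2) \<le> p t - p s" by (simp add: algebra_simps)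
  have p0: "0 \<le> (1 - c) * (t\<^sup>2 - s\<^sup>2)" using c sq by simp
  have "gauss_sum a b c * ((1 - c) * (t\<^sup>2 - s\<^sup>2)) \<le> E (1 - t\<^sup>2) * (p t - p s)"
    using gauss_series_ge[of "1 - t\<^sup>2"] sq G p p0 by (intro mult_mono) (auto simp: E_def)
  moreover have "0 \<le> p s * (E (1 - t\<^sup>2) - E (1 - s\<^sup>2))"
    unfolding E_def p_def using gauss_series_antimono[of "1 - t\<^sup>2" "1 - s\<^sup>2"] sq
    by (intro mult_nonneg_nonneg) auto
  moreover have "lommel_weight a b c x = p x * E (1 - x\<^sup>2)" for x
    by (simp add: lommel_weight_def p_def E_def)
  ultimately show ?thesis by (simp add: algebra_simps)
qed

lemma lommel_weight_nonneg:
  assumes "0 \<le> t" "t \<le> 1"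
  shows "0 \<le> lommel_weight a b c t"
proof -
  have "0 < gauss_sum a b c" by (rule gauss_sum_pos) (use ab c in auto)
  thus ?thesis
    using gauss_series_ge[of "1 - t\<^sup>2"] assms
    by (auto simp: lommel_weight_def power_le_one intro!: mult_nonneg_nonneg)
qed

lemma one_minus_square_powr_power:
  assumes "0 \<le> t" "t \<le> 1"
  shows "(1 - t\<^sup>2) powr (c - 1) * (1 - t\<^sup>2) ^ m = (1 - t\<^sup>2) powr (c + real m - 1)"
proof (cases "t = 1")
  case False
  hence "1 - t\<^sup>2 > 0" using assms by (simp add: power_less_one_iff abs_square_less_1)
  thus ?thesis by (simp add: powr_realpow[symmetric] powr_add[symmetric] algebra_simps)
qed simp

lemma lommel_weight_integrable: "lommel_weight a b c integrable_on {0..1}"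
proof -
  have "(\<lambda>t. (1 - t\<^sup>2) powr (c - 1) *\<^sub>R (\<Sum>m. gauss_term a b c m * (1 - t\<^sup>2) ^ m)) integrable_on {0..1}"
  proof (rule weighted_series_integral(1))
    show "(\<lambda>t. (1 - t\<^sup>2) powr (c - 1)) integrable_on {0..1}"
      by (rule one_minus_square_powr_integrable[OF c(1)])
    show "((\<lambda>t. (1 - t\<^sup>2) powr (c - 1) *\<^sub>R (gauss_term a b c m * (1 - t\<^sup>2) ^ m)) has_integral
        gauss_term a b c m * integral {0..1} (\<lambda>t. (1 - t\<^sup>2) powr (c + real m - 1))) {0..1}" for m
    proof -
      have "((\<lambda>t. gauss_term a b c m * (1 - t\<^sup>2) powr (c + real m - 1)) has_integral
        gauss_term a b c m * integral {0..1} (\<lambda>t. (1 - t\<^sup>2) powr (c + real m - 1))) {0..1}"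
        by (intro has_integral_mult_right integrable_integral one_minus_square_powr_integrable)
           (use c in auto)
      thus ?thesis
        by (rule has_integral_eq[rotated]) (simp add: one_minus_square_powr_power[symmetric])
    qed
    show "norm (gauss_term a b c m * (1 - t\<^sup>2) ^ m) \<le> \<bar>gauss_term a b c m\<bar>" if "t \<in> {0..1}" for m t
      by (rule gauss_term_power_le) (use that in \<open>auto simp: power_le_one\<close>)
  qed (auto intro: gauss_term_abs_summable)
  thus ?thesis by (simp add: lommel_weight_def[abs_def])
qed

text \<open>
  Integrating termwise shifts the lower parameter:
  \<open>1 / ((c)\<^sub>m (c + m)\<^bsub>n+1\<^esub>) = 1 / ((c)\<^bsub>n+1\<^esub> (c + n + 1)\<^sub>m)\<close>, so the series of moments is again a Gauss
  sum.
\<close>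
lemma lommel_weight_moment:
  "((\<lambda>t. lommel_weight a b c t * t ^ (2 * n + 1)) has_integral lommel_moment a b c n) {0..1}"
proof -
  define p where "p = (\<lambda>t::real. (1 - t\<^sup>2) powr (c - 1) * t ^ (2 * n + 1))"
  define y where "y = (\<lambda>m. gauss_term a b c m * (fact n / (2 * pochhammer (c + real m) (Suc n))))"
  have pi: "p integrable_on {0..1}"
    unfolding p_def using has_integral_one_minus_square_moment[OF c(1)] by blast
  have ym: "((\<lambda>t. p t *\<^sub>R (gauss_term a b c m * (1 - t\<^sup>2) ^ m)) has_integral y m) {0..1}" for m
  proof -
    have "((\<lambda>t. gauss_term a b c m * ((1 - t\<^sup>2) powr (c + real m - 1) * t ^ (2 * n + 1))) has_integral y m) {0..1}"
      unfolding y_def by (intro has_integral_mult_right has_integral_one_minus_square_moment) (use c in auto)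
    thus ?thesis
      by (rule has_integral_eq[rotated]) (simp add: one_minus_square_powr_power[symmetric] p_def)
  qed
  have bd: "norm (gauss_term a b c m * (1 - t\<^sup>2) ^ m) \<le> \<bar>gauss_term a b c m\<bar>" if "t \<in> {0..1}" for m t
    by (rule gauss_term_power_le) (use that in \<open>auto simp: power_le_one\<close>)
  have p0: "0 \<le> p t" if "t \<in> {0..1}" for t using that by (simp add: p_def)
  note ws = weighted_series_integral[OF pi p0 ym bd gauss_term_abs_summable]
  have yeq: "y m = fact n / (2 * pochhammer c (Suc n)) * gauss_term a b (c + real (Suc n)) m" for m
  proof -
    have "pochhammer c m * pochhammer (c + real m) (Suc n)
        = pochhammer c (Suc n) * pochhammer (c + real (Suc n)) m"
      using pochhammer_product'[of c m "Suc n"] pochhammer_product'[of c "Suc n" m]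
      by (simp only: add.commute)
    thus ?thesis
      unfolding y_def gauss_term_def by (simp add: divide_inverse flip: inverse_mult_distrib)
  qed
  have "gauss_term a b (c + real (Suc n)) sums gauss_sum a b (c + real (Suc n))"
    unfolding gauss_sum_def by (intro summable_sums gauss_summable_lim) (use ab c in auto)
  hence "y sums lommel_moment a b c n"
    unfolding yeq lommel_moment_def by (rule sums_mult)
  with ws(2) have "integral {0..1} (\<lambda>t. p t *\<^sub>R (\<Sum>m. gauss_term a b c m * (1 - t\<^sup>2) ^ m)) = lommel_moment a b c n"
    by (rule sums_unique2)
  hence "((\<lambda>t. p t *\<^sub>R (\<Sum>m. gauss_term a b c m * (1 - t\<^sup>2) ^ m)) has_integral lommel_moment a b c n) {0..1}"
    using ws(1) by (simp add: has_integral_integrable_integral)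
  thus ?thesis
    by (simp add: p_def lommel_weight_def mult_ac)
qed

lemma lommel_moment_Suc:
  "lommel_moment a b c (Suc n) * ((real n + c + 1 - a) * (real n + c + 1 - b))
     = lommel_moment a b c n * ((real n + 1) * (real n + 1 + c - a - b))"
proof -
  define x where "x = c + real (Suc n)"
  have x: "x > 0" "x - a - b > 0" using c by (auto simp: x_def)
  define K where "K = fact n / (2 * pochhammer c (Suc n))"
  have shift: "real n + c + 1 - a = x - a" "real n + c + 1 - b = x - b"
    "real n + 1 + c - a - b = x - a - b"
    by (simp_all add: x_def)
  have "lommel_moment a b c (Suc n) = (real n + 1) / x * K * gauss_sum a b (x + 1)"
    unfolding lommel_moment_def pochhammer_Suc[of c "Suc n"] x_def[symmetric] K_def
    by (simp add: x_def add_ac)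
  hence "lommel_moment a b c (Suc n) * ((x - a) * (x - b))
      = (real n + 1) / x * K * ((x - a) * (x - b) * gauss_sum a b (x + 1))"
    by (simp add: mult_ac)
  also have "(x - a) * (x - b) * gauss_sum a b (x + 1) = x * (x - a - b) * gauss_sum a b x"
    by (rule gauss_sum_rec[OF ab x, symmetric])
  also have "(real n + 1) / x * K * (x * (x - a - b) * gauss_sum a b x)
      = K * gauss_sum a b x * ((real n + 1) * (x - a - b))"
    using x by simp
  also have "K * gauss_sum a b x = lommel_moment a b c n"
    by (simp add: lommel_moment_def x_def K_def)
  finally show ?thesis unfolding shift .
qed

lemma lommel_moment_pos: "lommel_moment a b c n > 0"
  unfolding lommel_moment_def using ab c
  by (intro mult_pos_pos divide_pos_pos gauss_sum_pos pochhammer_pos) auto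

text \<open>
  The condition \<open>c - a - b = 1 / 2\<close> turns the recursion factor \<open>(n + 1) * (n + 1 + c - a - b)\<close> into
  \<open>(2 * n + 2) * (2 * n + 3) / 4\<close>, the quotient of the factorials that occur in the sine series.
\<close>
lemma lommel_moment_eq:
  "lommel_moment a b c n / fact (2 * n + 1)
     = lommel_moment a b c 0 / (4 ^ n * pochhammer (c + 1 - a) n * pochhammer (c + 1 - b) n)"
  if half: "c - a - b = 1 / 2"
proof (induction n)
  case (Suc n)
  define A B where "A = real n + c + 1 - a" and "B = real n + c + 1 - b"
  have AB: "A > 0" "B > 0" using c by (auto simp: A_def B_def)
  have half': "real n + 1 + c - a - b = real n + 3 / 2" using half by simp
  define P where "P = (real n + 1) * (real n + 3 / 2)"
  have P: "P > 0" unfolding P_def by (intro mult_pos_pos) auto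
  have "lommel_moment a b c (Suc n) * (A * B) = lommel_moment a b c n * P"
    using lommel_moment_Suc[of n] unfolding half' A_def[symmetric] B_def[symmetric] P_def .
  hence M: "lommel_moment a b c (Suc n) = lommel_moment a b c n * P / (A * B)"
    using AB by (subst eq_divide_eq) auto
  have F: "fact (2 * Suc n + 1) = 4 * P * (fact (2 * n + 1) :: real)"
    by (simp add: field_simps P_def)
  have "lommel_moment a b c (Suc n) / fact (2 * Suc n + 1)
      = lommel_moment a b c n / fact (2 * n + 1) / (4 * (A * B))"
    unfolding M F using P by simp
  also have "\<dots> = lommel_moment a b c 0 / (4 ^ Suc n * pochhammer (c + 1 - a) (Suc n) * pochhammer (c + 1 - b) (Suc n))"
  proof -
    have pA: "pochhammer (c + 1 - a) (Suc n) = pochhammer (c + 1 - a) n * A"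
      and pB: "pochhammer (c + 1 - b) (Suc n) = pochhammer (c + 1 - b) n * B"
      by (simp_all add: pochhammer_Suc A_def B_def algebra_simps)
    show ?thesis unfolding Suc.IH pA pB power_Suc by (simp only: divide_divide_eq_left mult_ac)
  qed
  finally show ?case .
qed simp

lemma lommel_sine_transform:
  fixes z :: complex
  assumes half: "c - a - b = 1 / 2"
  shows "((\<lambda>t. lommel_weight a b c t *\<^sub>R sin (z * of_real t)) has_integral
     of_real (lommel_moment a b c 0) * z
       * hypergeo_1F2 1 (of_real (c + 1 - a)) (of_real (c + 1 - b)) (- (z\<^sup>2 / 4))) {0..1}"
proof -
  define q where "q = (\<lambda>n (w::complex). (-1) ^ n * w ^ (2 * n + 1) / fact (2 * n + 1))"
  have sinq: "(\<lambda>n. q n w) sums sin w" for w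
  proof -
    have "strict_mono (\<lambda>n::nat. 2 * n + 1)" by (simp add: strict_mono_def)
    moreover have "sin_coeff n *\<^sub>R w ^ n = 0" if "n \<notin> range (\<lambda>n::nat. 2 * n + 1)" for n
    proof -
      have "even n" using that by (metis oddE rangeI)
      thus ?thesis by (simp add: sin_coeff_def)
    qed
    ultimately have "(\<lambda>n. sin_coeff (2 * n + 1) *\<^sub>R w ^ (2 * n + 1)) sums sin w"
      using sums_mono_reindex[of "\<lambda>n. 2 * n + 1" "\<lambda>n. sin_coeff n *\<^sub>R w ^ n" "sin w"] sin_converges by blast
    thus ?thesis
      by (simp add: q_def sin_coeff_def scaleR_conv_of_real)
  qed
  define y where "y = (\<lambda>n. (-1) ^ n * z ^ (2 * n + 1) * of_real (lommel_moment a b c n / fact (2 * n + 1)))"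
  have yn: "((\<lambda>t. lommel_weight a b c t *\<^sub>R q n (z * of_real t)) has_integral y n) {0..1}" for n
  proof -
    have "((\<lambda>t. complex_of_real (lommel_weight a b c t * t ^ (2 * n + 1))) has_integral
        of_real (lommel_moment a b c n)) {0..1}"
      by (rule has_integral_of_real[OF lommel_weight_moment])
    hence "((\<lambda>t. ((-1) ^ n * z ^ (2 * n + 1) / fact (2 * n + 1)) * complex_of_real (lommel_weight a b c t * t ^ (2 * n + 1)))
        has_integral ((-1) ^ n * z ^ (2 * n + 1) / fact (2 * n + 1)) * of_real (lommel_moment a b c n)) {0..1}"
      by (rule has_integral_mult_right)
    thus ?thesis
      by (simp add: y_def q_def scaleR_conv_of_real power_mult_distrib mult_ac)
  qed
  have bd: "norm (q n (z * of_real t)) \<le> norm z ^ (2 * n + 1) / fact (2 * n + 1)" if "t \<in> {0..1}" for n t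
  proof -
    have "norm (q n (z * of_real t)) = norm z ^ (2 * n + 1) * t ^ (2 * n + 1) / fact (2 * n + 1)"
      using that by (simp add: q_def norm_mult norm_divide norm_power power_mult_distrib del: power_Suc fact_Suc)
    also have "\<dots> \<le> norm z ^ (2 * n + 1) / fact (2 * n + 1)"
      using that by (intro divide_right_mono mult_left_le power_le_one) auto
    finally show ?thesis .
  qed
  have "summable (\<lambda>n. norm z ^ n / fact n)"
    using summable_norm_exp[of "norm z"] by (simp add: divide_inverse mult.commute)
  hence sm: "summable (\<lambda>n. norm z ^ (2 * n + 1) / fact (2 * n + 1))"
    using summable_reindex[of "\<lambda>n. norm z ^ n / fact n" "\<lambda>n. 2 * n + 1"] by (simp add: inj_def o_def)
  have nonneg: "0 \<le> lommel_weight a b c t" if "t \<in> {0..1}" for t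
    using lommel_weight_nonneg that by simp
  note ws = weighted_series_integral[OF lommel_weight_integrable nonneg yn bd sm]
  have sinsum: "(\<Sum>n. q n (z * of_real t)) = sin (z * of_real t)" for t
    by (rule sums_unique[OF sinq, symmetric])
  have "(\<lambda>n. of_real (lommel_moment a b c 0) * z * (pochhammer 1 n
      / (pochhammer (of_real (c + 1 - a)) n * pochhammer (of_real (c + 1 - b)) n) * ((- (z\<^sup>2 / 4)) ^ n / fact n)))
    sums (of_real (lommel_moment a b c 0) * z
       * hypergeo_1F2 1 (of_real (c + 1 - a)) (of_real (c + 1 - b)) (- (z\<^sup>2 / 4)))"
    by (intro sums_mult hypergeo_1F2_sums)
  moreover have "of_real (lommel_moment a b c 0) * z * (pochhammer 1 n
      / (pochhammer (of_real (c + 1 - a)) n * pochhammer (of_real (c + 1 - b)) n) * ((- (z\<^sup>2 / 4)) ^ n / fact n)) = y n" for n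
  proof -
    have pow: "(- (z\<^sup>2 / 4)) ^ n = (-1) ^ n * z ^ (2 * n) / 4 ^ n"
      by (subst power_minus) (simp add: power_divide power_mult)
    define P Q where "P = complex_of_real (pochhammer (c + 1 - a) n)"
      and "Q = complex_of_real (pochhammer (c + 1 - b) n)"
    have J: "of_real (lommel_moment a b c n / fact (2 * n + 1))
        = complex_of_real (lommel_moment a b c 0) / (4 ^ n * P * Q)"
      unfolding lommel_moment_eq[OF half] P_def Q_def
      by (simp only: of_real_divide of_real_mult of_real_power of_real_numeral)
    have cancel: "pochhammer 1 n / (P * Q) * (W / fact n) = W / (P * Q)" for W
      by (simp add: pochhammer_fact[symmetric])
    show ?thesis
      unfolding y_def J pow pochhammer_of_real P_def[symmetric] Q_def[symmetric] cancel
      by (simp add: divide_inverse mult_ac)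
  qed
  ultimately have "y sums (of_real (lommel_moment a b c 0) * z
       * hypergeo_1F2 1 (of_real (c + 1 - a)) (of_real (c + 1 - b)) (- (z\<^sup>2 / 4)))"
    by (simp only:)
  from sums_unique2[OF ws(2) this] ws(1) show ?thesis
    unfolding sinsum has_integral_iff by (intro conjI)
qed

end

section \<open>The zeros of the hypergeometric function\<close>

lemma hypergeo_1F2_holomorphic: "hypergeo_1F2 a b c holomorphic_on UNIV"
proof -
  have "hypergeo_1F2 a b c holomorphic_on ball 0 r" for r
  proof (rule power_series_holomorphic)
    fix w
    show "(\<lambda>n. (pochhammer a n / (pochhammer b n * pochhammer c n) / fact n) * (w - 0) ^ n) sums hypergeo_1F2 a b c w"
      using hypergeo_1F2_sums[of a b c w] by simp
  qed
  hence "hypergeo_1F2 a b c holomorphic_on (\<Union>r. ball 0 r)"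
    by (intro holomorphic_on_UN_open) auto
  moreover have "(\<Union>r. ball (0::complex) r) = UNIV"
    by (auto intro: exI[of _ "norm x + 1" for x :: complex] gt_ex)
  ultimately show ?thesis by simp
qed

lemma hypergeo_1F2_pos:
  fixes b c x :: real
  assumes "b > 0" "c > 0" "x \<ge> 0"
  shows "Re (hypergeo_1F2 1 (of_real b) (of_real c) (of_real x)) > 0"
proof -
  define a where "a = (\<lambda>n. x ^ n / (pochhammer b n * pochhammer c n))"
  have "pochhammer 1 n / (pochhammer (of_real b) n * pochhammer (of_real c) n) * (of_real x ^ n / fact n)
      = complex_of_real (a n)" for n
  proof -
    have "pochhammer 1 n = (fact n :: complex)" by (simp only: pochhammer_fact)
    thus ?thesis unfolding a_def pochhammer_of_real by simp
  qed
  hence "(\<lambda>n. complex_of_real (a n)) sums hypergeo_1F2 1 (of_real b) (of_real c) (of_real x)"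
    using hypergeo_1F2_sums[of 1 "of_real b" "of_real c" "of_real x"] by simp
  from sums_Re[OF this] have s: "a sums Re (hypergeo_1F2 1 (of_real b) (of_real c) (of_real x))"
    by simp
  have a_nonneg: "0 \<le> a n" for n
    unfolding a_def using assms by (intro divide_nonneg_pos mult_pos_pos pochhammer_pos) auto
  have "sum a {..<1} \<le> suminf a"
    by (rule sum_le_suminf) (use s a_nonneg in \<open>auto simp: sums_iff\<close>)
  moreover have "suminf a = Re (hypergeo_1F2 1 (of_real b) (of_real c) (of_real x))"
    using s by (simp add: sums_iff)
  moreover have "sum a {..<1} = 1" by (simp add: a_def)
  ultimately show ?thesis by linarith
qed

theorem corollary4p2:
  fixes \<mu> \<nu> :: real and F :: "complex \<Rightarrow> complex"
  assumes "\<mu> \<in> {-1/2<..<1/2}"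
    and "\<bar>\<nu>\<bar> \<in> {\<bar>\<mu>\<bar><..<\<mu> + 1}"
  defines "F \<equiv> (\<lambda>z. hypergeo_1F2 1 (of_real ((\<mu> - \<nu> + 3) / 2)) (of_real ((\<mu> + \<nu> + 3) / 2)) z)"
  shows "F holomorphic_on UNIV \<and>
    (\<forall>z. F z = 0 \<longrightarrow>
       z \<in> \<real> \<and> Re z < 0 \<and> zorder F z = 1 \<and>
       (\<exists>k::nat\<ge>1. Re z \<in> {- ((real k + 1)\<^sup>2 * pi\<^sup>2 / 4)<..<- ((real k)\<^sup>2 * pi\<^sup>2 / 4)})) \<and>
    (\<forall>k::nat\<ge>1. \<exists>!x::real.
       x \<in> {- ((real k + 1)\<^sup>2 * pi\<^sup>2 / 4)<..<- ((real k)\<^sup>2 * pi\<^sup>2 / 4)} \<and> F (of_real x) = 0)"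
proof -
  define a b c where "a = (\<mu> + \<nu>) / 2" and "b = (\<mu> - \<nu>) / 2" and "c = \<mu> + 1 / 2"
  have nu: "\<bar>\<mu>\<bar> < \<bar>\<nu>\<bar>" "\<bar>\<nu>\<bar> < \<mu> + 1" and mu: "- 1 / 2 < \<mu>" "\<mu> < 1 / 2"
    using assms by auto
  have "\<mu>\<^sup>2 < \<nu>\<^sup>2" using power_strict_mono[OF nu(1), of 2] by simp
  moreover have "a * b = (\<mu>\<^sup>2 - \<nu>\<^sup>2) / 4"
    by (simp add: a_def b_def field_simps power2_eq_square)
  ultimately have ab: "a > -1" "b > -1" "a * b < 0"
    using nu mu by (auto simp: a_def b_def)
  have c: "0 < c" "c < 1" "c - a - b > 0" "c > a" "c > b" and half: "c - a - b = 1 / 2"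
    using nu mu by (auto simp: a_def b_def c_def field_simps)
  have params: "c + 1 - a = (\<mu> - \<nu> + 3) / 2" "c + 1 - b = (\<mu> + \<nu> + 3) / 2"
    by (simp_all add: a_def b_def c_def field_simps)
  interpret lommel: lommel_parameters a b c
    using ab c by unfold_locales
  define J where "J = lommel_moment a b c 0"
  have J: "J > 0" unfolding J_def by (rule lommel.lommel_moment_pos)
  define G where "G = gauss_sum a b c"
  have G: "G > 0" unfolding G_def by (rule gauss_sum_pos) (use ab c in auto)
  define f where "f = lommel_weight a b c"
  have f: "f absolutely_integrable_on {0..1}"
    unfolding f_def using lommel.lommel_weight_nonneg lommel.lommel_weight_integrable
    by (intro nonnegative_absolutely_integrable_1) auto
  have f0: "f 0 > 0" unfolding f_def lommel_weight_0 using G by (simp add: G_def)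
  have growth: "G * (1 - c) * (t\<^sup>2 - s\<^sup>2) \<le> f t - f s" if "0 \<le> s" "s \<le> t" "t < 1" for s t
    unfolding f_def G_def by (rule lommel.lommel_weight_growth[OF that])
  have \<epsilon>: "G * (1 - c) > 0" using G c by simp
  define S where "S = (\<lambda>z. of_real J * z * F (- (z\<^sup>2 / 4)))"
  have S: "((\<lambda>t. f t *\<^sub>R sin (z * of_real t)) has_integral S z) {0..1}" for z
    unfolding f_def S_def J_def F_def params[symmetric]
    by (rule lommel.lommel_sine_transform[OF half])
  have holF: "F holomorphic_on UNIV"
    unfolding F_def by (rule hypergeo_1F2_holomorphic)
  have dF: "(F has_field_derivative deriv F w) (at w)" for w
    using holF by (intro holomorphic_derivI[of _ UNIV]) auto
  have dS: "(S has_field_derivative of_real J * F (- (z\<^sup>2 / 4))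
      + of_real J * z * (deriv F (- (z\<^sup>2 / 4)) * (- z / 2))) (at z)" for z
  proof -
    have "((\<lambda>z. - (z\<^sup>2 / 4)) has_field_derivative - z / 2) (at z)"
      by (auto intro!: derivative_eq_intros)
    from DERIV_chain2[OF dF this]
    have "((\<lambda>z. F (- (z\<^sup>2 / 4))) has_field_derivative deriv F (- (z\<^sup>2 / 4)) * (- z / 2)) (at z)" .
    moreover have "((\<lambda>z. of_real J * z) has_field_derivative of_real J) (at z)"
      by (auto intro!: derivative_eq_intros)
    ultimately show ?thesis
      unfolding S_def using DERIV_mult by (fastforce simp: algebra_simps)
  qed
  have holS: "S holomorphic_on UNIV"
    using dS by (auto simp: holomorphic_on_def field_differentiable_def)
  interpret weight: growing_sine_weight f "G * (1 - c)" S
    using f f0 \<epsilon> growth S holS by unfold_locales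
  have zero: "w \<in> \<real> \<and> Re w < 0 \<and> zorder F w = 1 \<and>
       (\<exists>k::nat\<ge>1. Re w \<in> {- ((real k + 1)\<^sup>2 * pi\<^sup>2 / 4)<..<- ((real k)\<^sup>2 * pi\<^sup>2 / 4)})"
    if Fw: "F w = 0" for w
  proof -
    define z where "z = 2 * csqrt (- w)"
    have zw: "- (z\<^sup>2 / 4) = w" by (simp add: z_def power_mult_distrib)
    have w_not: "\<not> (Im w = 0 \<and> Re w \<ge> 0)"
    proof
      assume "Im w = 0 \<and> Re w \<ge> 0"
      hence "w = of_real (Re w)" "Re w \<ge> 0" by (simp_all add: complex_eq_iff)
      moreover have "(\<mu> - \<nu> + 3) / 2 > 0" "(\<mu> + \<nu> + 3) / 2 > 0" using nu mu by auto
      ultimately have "Re (F w) > 0"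
        unfolding F_def by (metis hypergeo_1F2_pos)
      thus False using Fw by simp
    qed
    have Rez: "Re z > 0"
    proof -
      have "Re (csqrt (- w)) \<noteq> 0"
      proof
        assume "Re (csqrt (- w)) = 0"
        hence "csqrt (- w) = \<i> * of_real (Im (csqrt (- w)))" by (simp add: complex_eq_iff)
        hence "- w = (\<i> * of_real (Im (csqrt (- w))))\<^sup>2" by (metis power2_csqrt)
        hence "w = of_real ((Im (csqrt (- w)))\<^sup>2)" by (simp add: power_mult_distrib)
        hence "Im w = 0 \<and> Re w \<ge> 0" by (metis Im_complex_of_real Re_complex_of_real zero_le_power2)
        thus False using w_not by simp
      qed
      moreover have "Re (csqrt (- w)) \<ge> 0" by (rule Re_csqrt)
      ultimately show ?thesis by (simp add: z_def)
    qed
    have Sz: "S z = 0" by (simp add: S_def zw Fw)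
    note Z = weight.sine_transform_zeros[OF Rez Sz]
    define x where "x = Re z"
    have zx: "z = of_real x" using Z(1) by (simp add: x_def complex_eq_iff)
    have wx: "w = of_real (- (x\<^sup>2 / 4))" unfolding zw[symmetric] zx by simp
    have x0: "x > 0" using Rez by (simp add: x_def)
    obtain k :: nat where k: "k \<ge> 1" "real k * pi < x" "x < (real k + 1) * pi"
      using Z(2) unfolding x_def by blast
    have "(real k * pi)\<^sup>2 < x\<^sup>2" by (rule power_strict_mono) (use k in auto)
    moreover have "x\<^sup>2 < ((real k + 1) * pi)\<^sup>2" by (rule power_strict_mono) (use k x0 in auto)
    ultimately have "Re w \<in> {- ((real k + 1)\<^sup>2 * pi\<^sup>2 / 4)<..<- ((real k)\<^sup>2 * pi\<^sup>2 / 4)}"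
      unfolding wx Re_complex_of_real by (simp add: power_mult_distrib)
    moreover have "zorder F w = 1"
    proof (rule zorder_zero_eqI[OF holF])
      have "deriv S z = of_real J * F w + of_real J * z * (deriv F w * (- z / 2))"
        using DERIV_imp_deriv[OF dS[of z]] unfolding zw .
      hence "deriv F w \<noteq> 0" using Z(3) Fw by auto
      thus "(deriv ^^ nat 1) F w \<noteq> 0" by simp
    qed (use Fw in auto)
    moreover have "Re w < 0" "w \<in> \<real>" unfolding wx using x0 by auto
    ultimately show ?thesis using k(1) by blast
  qed
  have one: "\<exists>!x::real. x \<in> {- ((real k + 1)\<^sup>2 * pi\<^sup>2 / 4)<..<- ((real k)\<^sup>2 * pi\<^sup>2 / 4)} \<and> F (of_real x) = 0"
    if k: "k \<ge> 1" for k :: nat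
  proof -
    \<comment> \<open>The map sending \<open>x\<close> to \<open>2 * sqrt (- x)\<close> carries the \<open>k\<close>-th interval to \<open>(k \<pi>, (k + 1) \<pi>)\<close>. The
      condition \<open>x \<le> 0\<close> is part of the right-hand side because \<open>sqrt\<close> is odd.\<close>
    have key: "(x \<in> {- ((real k + 1)\<^sup>2 * pi\<^sup>2 / 4)<..<- ((real k)\<^sup>2 * pi\<^sup>2 / 4)} \<and> F (of_real x) = 0)
        \<longleftrightarrow> x \<le> 0 \<and> 2 * sqrt (- x) \<in> {real k * pi<..<(real k + 1) * pi} \<and> S (of_real (2 * sqrt (- x))) = 0" for x
    proof (cases "x < 0")
      case True
      define y where "y = 2 * sqrt (- x)"
      have y0: "y > 0" using True by (simp add: y_def)
      have y2: "y\<^sup>2 = - 4 * x" using True by (simp add: y_def power_mult_distrib)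
      have xy: "- ((complex_of_real y)\<^sup>2 / 4) = of_real x"
        unfolding of_real_power[symmetric] y2 by simp
      have sq: "p < q \<longleftrightarrow> p\<^sup>2 < q\<^sup>2" if "0 \<le> p" "0 \<le> q" for p q :: real
        using that by (simp flip: not_le)
      have "real k * pi < y \<longleftrightarrow> (real k * pi)\<^sup>2 < y\<^sup>2"
        using y0 by (intro sq) auto
      moreover have "y < (real k + 1) * pi \<longleftrightarrow> y\<^sup>2 < ((real k + 1) * pi)\<^sup>2"
        using y0 by (intro sq) auto
      moreover have "S (of_real y) = 0 \<longleftrightarrow> F (of_real x) = 0"
        using J y0 by (simp add: S_def xy)
      ultimately show ?thesis
        using True unfolding y_def[symmetric] by (auto simp: y2 power_mult_distrib)
    next
      case False
      have "0 \<le> (real k)\<^sup>2 * pi\<^sup>2 / 4" by simp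
      hence "\<not> x < - ((real k)\<^sup>2 * pi\<^sup>2 / 4)" using False by linarith
      moreover have "\<not> (x \<le> 0 \<and> real k * pi < 2 * sqrt (- x))" using False by (cases "x = 0") (auto simp: mult_less_0_iff)
      ultimately show ?thesis by auto
    qed
    obtain y where y: "y \<in> {real k * pi<..<(real k + 1) * pi}" "S (of_real y) = 0"
      and uniq: "\<And>y'. y' \<in> {real k * pi<..<(real k + 1) * pi} \<Longrightarrow> S (of_real y') = 0 \<Longrightarrow> y' = y"
      using weight.sine_transform_ex1_zero[OF k] by blast
    have "0 \<le> real k * pi" by simp
    moreover have "real k * pi < y" using y(1) by simp
    ultimately have y0: "y > 0" by (rule order.strict_trans1)
    have sy: "2 * sqrt (- (- (y\<^sup>2 / 4))) = y"
      using y0 by (simp add: real_sqrt_divide)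
    show ?thesis
      unfolding key
    proof (rule ex1I)
      show "- (y\<^sup>2 / 4) \<le> 0 \<and> 2 * sqrt (- (- (y\<^sup>2 / 4))) \<in> {real k * pi<..<(real k + 1) * pi}
          \<and> S (of_real (2 * sqrt (- (- (y\<^sup>2 / 4))))) = 0"
        unfolding sy using y by simp
      fix x assume x: "x \<le> 0 \<and> 2 * sqrt (- x) \<in> {real k * pi<..<(real k + 1) * pi}
          \<and> S (of_real (2 * sqrt (- x))) = 0"
      hence "2 * sqrt (- x) = y" using uniq by blast
      hence "y\<^sup>2 = - 4 * x" using x by (auto simp: power_mult_distrib)
      thus "x = - (y\<^sup>2 / 4)" by simp
    qed
  qed
  show ?thesis using holF zero one by blast
qed

end
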